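(* Let $n\geq 1$ and $d\geq 1$ be integers. A simplicial distribution $p:C^{(n)}\to D(\Delta_{\mathbb{Z}_d})$ is a contextual vertex of $\mathrm{sDist}(C^{(n)},\Delta_{\mathbb{Z}_d})$ if and only if it is a $k$-order cycle distribution for some $k\geq 2$.
   Context: Simplicial distributions. For a set $U$, $D(U)$ is the set of functions $p:U\to\mathbb{R}_{\geq 0}$ with finite support and $\sum_{u\in U}p(u)=1$; for a function $f:U\to V$, $D(f):D(U)\to D(V)$ is the push-forward $D(f)(p)(v)=\sum_{u\in f^{-1}(v)}p(u)$. For a simplicial set $Y$, $D(Y)$ is the simplicial set with $D(Y)_n=D(Y_n)$ and structure maps $D(d_i)$, $D(s_j)$. A simplicial distribution on $(X,Y)$ is a simplicial map $p:X\to D(Y)$; the set of these is $\mathrm{sDist}(X,Y)$, which is convex under simplex-wise convex combinations. Write $p_x=p(x)\in D(Y_n)$ for $x\in X_n$ and $p_x^y=p_x(y)$. For a simplicial map $\varphi:X\to Y$, the deterministic distribution $\delta^\varphi$ sends $x$ to the delta distribution at $\varphi(x)$. A simplicial distribution is noncontextual if it is a (finite) convex combination of deterministic distributions, and contextual otherwise. It is a vertex (extremal) if $p=\alpha q+(1-\alpha)\tilde q$ with $q,\tilde q\in \mathrm{sDist}(X,Y)$ and $0<\alpha\leq 1$ implies $p=q$. The $n$-circle $C^{(n)}$ is the $1$-dimensional simplicial set (a directed $n$-cycle) whose non-degenerate simplices are pairwise distinct $1$-simplices $\sigma_1,\dots,\sigma_n$ and pairwise distinct $0$-simplices $v_1,\dots,v_n$,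 with $d_1(\sigma_i)=v_i$, $d_0(\sigma_i)=d_1(\sigma_{i+1})$ for $1\leq i\leq n-1$, and $d_0(\sigma_n)=d_1(\sigma_1)$. $\mathbb{Z}_d=\{0,1,\dots,d-1\}$. For a set $U$, $\Delta_U$ is the simplicial set with $(\Delta_U)_n=U^{n+1}$, where $d_i$ deletes the coordinate $x_i$ of $(x_0,\dots,x_n)$ and $s_j$ repeats the coordinate $x_j$. For a simplicial distribution $p:C^{(n)}\to D(\Delta_{\mathbb{Z}_d})$, write $p_{\sigma_i}^{ab}=p_{\sigma_i}((a,b))$. $k$-order cycle distribution. Let $1\leq k\leq d$. A simplicial distribution $p:C^{(n)}\to D(\Delta_{\mathbb{Z}_d})$ is a $k$-order cycle distribution if there are elements $a_i^{(j)}\in\mathbb{Z}_d$ ($1\leq i\leq n$, $1\leq j\leq k$) with $a_i^{(j)}\neq a_i^{(s)}$ for all $i$ and all $j\neq s$, such that: for $1\leq i\leq n-1$, $p_{\sigma_i}^{ab}=\frac1k$ if $(a,b)=(a_i^{(j)},a_{i+1}^{(j)})$ for some $1\leq j\leq k$, and $p_{\sigma_i}^{ab}=0$ otherwise; and $p_{\sigma_n}^{ab}=\frac1k$ if $(a,b)=(a_n^{(j)},a_1^{(j+1)})$ for some $1\leq j\leq k-1$ or $(a,b)=(a_n^{(k)},a_1^{(1)})$, and $p_{\sigma_n}^{ab}=0$ otherwise. *)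

theory Defs
  imports "HOL-Probability.Probability_Mass_Function"
begin

section \<open>Simplicial sets and simplicial maps\<close>

text \<open>
  The first argument of \<open>face\<close> and \<open>degen\<close> is the degree of the simplex they are applied to:
  \<open>face X n i\<close> is $d_i : X_n \to X_{n-1}$ (for $n \geq 1$) and \<open>degen X n j\<close> is
  $s_j : X_n \to X_{n+1}$.
\<close>

record 'a sset =
  simplices :: "nat \<Rightarrow> 'a set"
  face :: "nat \<Rightarrow> nat \<Rightarrow> 'a \<Rightarrow> 'a"
  degen :: "nat \<Rightarrow> nat \<Rightarrow> 'a \<Rightarrow> 'a"

definition simplicial_set :: "'a sset \<Rightarrow> bool" where
  "simplicial_set X \<longleftrightarrow>
     (\<forall>n. \<forall>i\<le>Suc n. face X (Suc n) i \<in> simplices X (Suc n) \<rightarrow> simplices X n) \<and>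
     (\<forall>n. \<forall>j\<le>n. degen X n j \<in> simplices X n \<rightarrow> simplices X (Suc n)) \<and>
     (\<forall>n. \<forall>x\<in>simplices X (n + 2). \<forall>i j. i < j \<and> j \<le> n + 2 \<longrightarrow>
        face X (n + 1) i (face X (n + 2) j x) = face X (n + 1) (j - 1) (face X (n + 2) i x)) \<and>
     (\<forall>n. \<forall>x\<in>simplices X (n + 1). \<forall>i j. i < j \<and> j \<le> n + 1 \<longrightarrow>
        face X (n + 2) i (degen X (n + 1) j x) = degen X n (j - 1) (face X (n + 1) i x)) \<and>
     (\<forall>n. \<forall>x\<in>simplices X n. \<forall>j\<le>n.
        face X (n + 1) j (degen X n j x) = x \<and> face X (n + 1) (j + 1) (degen X n j x) = x) \<and>
     (\<forall>n. \<forall>x\<in>simplices X (n + 1). \<forall>i j. j + 1 < i \<and> i \<le> n + 2 \<longrightarrow>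
        face X (n + 2) i (degen X (n + 1) j x) = degen X n j (face X (n + 1) (i - 1) x)) \<and>
     (\<forall>n. \<forall>x\<in>simplices X n. \<forall>i j. i \<le> j \<and> j \<le> n \<longrightarrow>
        degen X (n + 1) i (degen X n j x) = degen X (n + 1) (j + 1) (degen X n i x))"

definition nondegenerate :: "'a sset \<Rightarrow> nat \<Rightarrow> 'a set" where
  "nondegenerate X n =
     {x \<in> simplices X n. \<not> (\<exists>m j y. n = Suc m \<and> j \<le> m \<and> y \<in> simplices X m \<and> x = degen X m j y)}"

text \<open>
  Simplicial maps are extensional (\<open>undefined\<close> off the simplices of \<open>X\<close>), so HOL equality of
  elements of \<open>simplicial_maps X Y\<close> is equality of simplicial maps.
\<close>

definition simplicial_maps :: "'a sset \<Rightarrow> 'b sset \<Rightarrow> (nat \<Rightarrow> 'a \<Rightarrow> 'b) set" where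
  "simplicial_maps X Y =
     {f. (\<forall>n. f n \<in> simplices X n \<rightarrow>\<^sub>E simplices Y n) \<and>
         (\<forall>n. \<forall>x\<in>simplices X (Suc n). \<forall>i\<le>Suc n.
            f n (face X (Suc n) i x) = face Y (Suc n) i (f (Suc n) x)) \<and>
         (\<forall>n. \<forall>x\<in>simplices X n. \<forall>j\<le>n.
            f (Suc n) (degen X n j x) = degen Y n j (f n x))}"


section \<open>Simplicial distributions\<close>

text \<open>
  A finitely supported probability distribution on a set \<open>U\<close> is a \<open>pmf\<close> whose support is finite
  and contained in \<open>U\<close>; the push-forward along \<open>f\<close> is \<open>map_pmf f\<close>.
\<close>

definition fdist :: "'a set \<Rightarrow> 'a pmf set" where
  "fdist U = {p. finite (set_pmf p) \<and> set_pmf p \<subseteq> U}"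

definition dist_sset :: "'a sset \<Rightarrow> 'a pmf sset" where
  "dist_sset Y =
     \<lparr>simplices = \<lambda>n. fdist (simplices Y n),
      face = \<lambda>n i. map_pmf (face Y n i),
      degen = \<lambda>n j. map_pmf (degen Y n j)\<rparr>"

definition sDist :: "'a sset \<Rightarrow> 'b sset \<Rightarrow> (nat \<Rightarrow> 'a \<Rightarrow> 'b pmf) set" where
  "sDist X Y = simplicial_maps X (dist_sset Y)"

definition deterministic :: "'a sset \<Rightarrow> (nat \<Rightarrow> 'a \<Rightarrow> 'b) \<Rightarrow> nat \<Rightarrow> 'a \<Rightarrow> 'b pmf" where
  "deterministic X \<phi> = (\<lambda>n. \<lambda>x\<in>simplices X n. return_pmf (\<phi> n x))"

definition noncontextual :: "'a sset \<Rightarrow> 'b sset \<Rightarrow> (nat \<Rightarrow> 'a \<Rightarrow> 'b pmf) \<Rightarrow> bool" where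
  "noncontextual X Y p \<longleftrightarrow>
     p \<in> sDist X Y \<and>
     (\<exists>S w. finite S \<and> S \<subseteq> simplicial_maps X Y \<and>
        (\<forall>\<phi>\<in>S. (0::real) \<le> w \<phi>) \<and> (\<Sum>\<phi>\<in>S. w \<phi>) = 1 \<and>
        (\<forall>n. \<forall>x\<in>simplices X n. \<forall>y.
           pmf (p n x) y = (\<Sum>\<phi>\<in>S. w \<phi> * pmf (deterministic X \<phi> n x) y)))"

definition contextual :: "'a sset \<Rightarrow> 'b sset \<Rightarrow> (nat \<Rightarrow> 'a \<Rightarrow> 'b pmf) \<Rightarrow> bool" where
  "contextual X Y p \<longleftrightarrow> p \<in> sDist X Y \<and> \<not> noncontextual X Y p"

definition is_vertex :: "'a sset \<Rightarrow> 'b sset \<Rightarrow> (nat \<Rightarrow> 'a \<Rightarrow> 'b pmf) \<Rightarrow> bool" where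
  "is_vertex X Y p \<longleftrightarrow>
     p \<in> sDist X Y \<and>
     (\<forall>q\<in>sDist X Y. \<forall>q'\<in>sDist X Y. \<forall>\<alpha>::real. 0 < \<alpha> \<and> \<alpha> \<le> 1 \<and>
        (\<forall>n. \<forall>x\<in>simplices X n. \<forall>y.
           pmf (p n x) y = \<alpha> * pmf (q n x) y + (1 - \<alpha>) * pmf (q' n x) y)
        \<longrightarrow> p = q)"

text \<open>The simplicial set $D(Y)$ is indeed a simplicial set, and $\delta^\varphi$ lives on it.\<close>

lemma pmf_map_cong_set:
  "\<lbrakk>p \<in> fdist U; \<And>u. u \<in> U \<Longrightarrow> f u = g u\<rbrakk> \<Longrightarrow> map_pmf f p = map_pmf g p"
  by (rule map_pmf_cong) (auto simp: fdist_def)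

lemma simplicial_set_dist_sset:
  assumes "simplicial_set Y"
  shows "simplicial_set (dist_sset Y)"
proof -
  have map_in: "map_pmf f p \<in> fdist V" if "p \<in> fdist U" "f \<in> U \<rightarrow> V" for f :: "'a \<Rightarrow> 'a" and p U V
    using that by (auto simp: fdist_def)
  have map_id: "map_pmf f p = p" if "p \<in> fdist U" "\<And>u. u \<in> U \<Longrightarrow> f u = u"
    for f :: "'a \<Rightarrow> 'a" and p U
    using pmf_map_cong_set[OF that(1), of f "\<lambda>u. u"] that(2) by simp
  show ?thesis
    using assms unfolding simplicial_set_def dist_sset_def sset.simps pmf.map_comp
    apply (elim conjE)
    apply (intro conjI allI impI ballI)
           apply (blast intro: map_in funcsetI)
          apply (blast intro: map_in funcsetI)
         apply (rule pmf_map_cong_set, assumption, simp)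
        apply (rule pmf_map_cong_set, assumption, simp)
       apply (rule map_id, assumption, simp)
      apply (rule map_id, assumption, simp)
     apply (rule pmf_map_cong_set, assumption, simp)
    apply (rule pmf_map_cong_set, assumption, simp)
    done
qed

lemma face_closed:
  assumes "simplicial_set X" "x \<in> simplices X (Suc n)" "i \<le> Suc n"
  shows "face X (Suc n) i x \<in> simplices X n"
proof -
  have "face X (Suc n) i \<in> simplices X (Suc n) \<rightarrow> simplices X n"
    using assms(1,3) unfolding simplicial_set_def by (elim conjE) simp
  then show ?thesis
    using assms(2) by (rule funcset_mem)
qed

lemma degen_closed:
  assumes "simplicial_set X" "x \<in> simplices X n" "j \<le> n"
  shows "degen X n j x \<in> simplices X (Suc n)"
proof -
  have "degen X n j \<in> simplices X n \<rightarrow> simplices X (Suc n)"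
    using assms(1,3) unfolding simplicial_set_def by (elim conjE) simp
  then show ?thesis
    using assms(2) by (rule funcset_mem)
qed

lemma deterministic_in_sDist:
  assumes "simplicial_set X" "\<phi> \<in> simplicial_maps X Y"
  shows "deterministic X \<phi> \<in> sDist X Y"
  using assms(2) face_closed[OF assms(1)] degen_closed[OF assms(1)]
  unfolding sDist_def simplicial_maps_def deterministic_def dist_sset_def fdist_def
  by (auto simp: PiE_iff)


section \<open>The simplicial set $\Delta_U$\<close>

text \<open>An \<open>n\<close>-simplex $(x_0,\dots,x_n)$ is the list of length \<open>n + 1\<close>.\<close>

definition delete_nth :: "nat \<Rightarrow> 'a list \<Rightarrow> 'a list" where
  "delete_nth i xs = take i xs @ drop (Suc i) xs"

definition repeat_nth :: "nat \<Rightarrow> 'a list \<Rightarrow> 'a list" where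
  "repeat_nth j xs = take (Suc j) xs @ drop j xs"

definition Delta_sset :: "'a set \<Rightarrow> 'a list sset" where
  "Delta_sset U =
     \<lparr>simplices = \<lambda>n. {xs. length xs = Suc n \<and> set xs \<subseteq> U},
      face = \<lambda>n i. delete_nth i,
      degen = \<lambda>n j. repeat_nth j\<rparr>"

definition Zd :: "nat \<Rightarrow> nat set" where
  "Zd d = {0..<d}"

lemma length_delete_nth: "i < length xs \<Longrightarrow> length (delete_nth i xs) = length xs - 1"
  by (auto simp: delete_nth_def)

lemma length_repeat_nth: "j < length xs \<Longrightarrow> length (repeat_nth j xs) = Suc (length xs)"
  by (auto simp: repeat_nth_def)

lemma nth_delete_nth:
  "i < length xs \<Longrightarrow> k < length xs - 1 \<Longrightarrow> delete_nth i xs ! k = xs ! (if k < i then k else Suc k)"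
  by (auto simp: delete_nth_def nth_append min_def)

lemma nth_repeat_nth:
  "j < length xs \<Longrightarrow> k < Suc (length xs) \<Longrightarrow>
   repeat_nth j xs ! k = xs ! (if k \<le> j then k else k - 1)"
  by (auto simp: repeat_nth_def nth_append min_def intro: arg_cong[where f = "nth xs"])

lemma set_delete_nth: "set (delete_nth i xs) \<subseteq> set xs"
  by (auto simp: delete_nth_def dest: in_set_takeD in_set_dropD)

lemma set_repeat_nth: "set (repeat_nth j xs) \<subseteq> set xs"
  by (auto simp: repeat_nth_def dest: in_set_takeD in_set_dropD)

lemma simplicial_set_Delta: "simplicial_set (Delta_sset U)"
proof -
  note simps = length_delete_nth length_repeat_nth nth_delete_nth nth_repeat_nth
  have dd: "delete_nth i (delete_nth j x) = delete_nth (j - 1) (delete_nth i x)"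
    if "i < j" "j < length x" for i j and x :: "'a list"
    using that by (intro nth_equalityI) (auto simp: simps)
  have ds: "delete_nth i (repeat_nth j x) = repeat_nth (j - 1) (delete_nth i x)"
    if "i < j" "j < length x" for i j and x :: "'a list"
    using that by (intro nth_equalityI) (auto simp: simps)
  have del_rep: "delete_nth j (repeat_nth j x) = x \<and> delete_nth (Suc j) (repeat_nth j x) = x"
    if "j < length x" for j and x :: "'a list"
    using that by (intro conjI nth_equalityI) (auto simp: simps)
  have ds2: "delete_nth i (repeat_nth j x) = repeat_nth j (delete_nth (i - 1) x)"
    if "Suc j < i" "i \<le> length x" for i j and x :: "'a list"
    using that by (intro nth_equalityI) (auto simp: simps)
  have ss: "repeat_nth i (repeat_nth j x) = repeat_nth (Suc j) (repeat_nth i x)"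
    if "i \<le> j" "j < length x" for i j and x :: "'a list"
    using that by (intro nth_equalityI) (auto simp: simps)
  show ?thesis
    unfolding simplicial_set_def Delta_sset_def sset.simps
    apply (intro conjI allI impI ballI)
    subgoal premises prems for n i
      using prems
      by (intro funcsetI CollectI conjI order_trans[OF set_delete_nth]) (simp_all add: length_delete_nth)
    subgoal premises prems for n j
      using prems
      by (intro funcsetI CollectI conjI order_trans[OF set_repeat_nth]) (simp_all add: length_repeat_nth)
    subgoal premises prems for n x i j using dd[of i j x] prems by simp
    subgoal premises prems for n x i j using ds[of i j x] prems by simp
    subgoal premises prems for n x j using del_rep[of j x] prems by simp
    subgoal premises prems for n x j using del_rep[of j x] prems by simp
    subgoal premises prems for n x i j using ds2[of j i x] prems by simp
    subgoal premises prems for n x i j using ss[of i j x] prems by simp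
    done
qed


section \<open>The \<open>n\<close>-circle\<close>

text \<open>
  A simplex of degree \<open>m\<close> is encoded as a pair \<open>(i, t)\<close> with \<open>1 \<le> i \<le> n\<close> and \<open>1 \<le> t \<le> m + 1\<close>.
  For \<open>t \<le> m\<close> it is $\theta^*\sigma_i$, where $\theta : [m] \to [1]$ is the monotone surjection
  sending the first \<open>t\<close> elements to \<open>0\<close> and the others to \<open>1\<close>; for \<open>t = m + 1\<close> it is the
  iterated degeneracy of $v_i$ (the first vertex of $\sigma_i$).  Deleting the only element
  sent to \<open>0\<close> gives a degeneracy of the last vertex of $\sigma_i$.
\<close>

definition circle_next :: "nat \<Rightarrow> nat \<Rightarrow> nat" where
  "circle_next n i = (if i = n then 1 else Suc i)"

definition circle_sset :: "nat \<Rightarrow> (nat \<times> nat) sset" where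
  "circle_sset n =
     \<lparr>simplices = \<lambda>m. {1..n} \<times> {1..Suc m},
      face = \<lambda>m j (i, t).
        if j < t then (if t = 1 then (circle_next n i, m) else (i, t - 1)) else (i, t),
      degen = \<lambda>m j (i, t). if j < t then (i, t + 1) else (i, t)\<rparr>"

definition circle_vertex :: "nat \<Rightarrow> nat \<times> nat" where
  "circle_vertex i = (i, 1)"

definition circle_edge :: "nat \<Rightarrow> nat \<times> nat" where
  "circle_edge i = (i, 1)"

lemma simplicial_set_circle: "simplicial_set (circle_sset n)"
  unfolding simplicial_set_def circle_sset_def sset.simps
  apply (intro conjI allI impI ballI)
  subgoal by (rule funcsetI, clarsimp simp: circle_next_def, linarith)
  subgoal by (rule funcsetI, clarsimp)
  subgoal premises prems for m x i j
    using prems by (cases x) (auto simp: circle_next_def)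
  subgoal premises prems for m x i j
    using prems by (cases x) (auto simp: circle_next_def)
  subgoal premises prems for m x j
    using prems by (cases x) auto
  subgoal premises prems for m x j
    using prems by (cases x) auto
  subgoal premises prems for m x i j
    using prems by (cases x) (auto simp: circle_next_def)
  subgoal premises prems for m x i j
    using prems by (cases x) auto
  done

lemma nondegenerate_circle:
  "nondegenerate (circle_sset n) 0 = circle_vertex ` {1..n}"
  "nondegenerate (circle_sset n) 1 = circle_edge ` {1..n}"
  "nondegenerate (circle_sset n) (m + 2) = {}"
proof -
  show "nondegenerate (circle_sset n) 0 = circle_vertex ` {1..n}"
    by (auto simp: nondegenerate_def circle_sset_def circle_vertex_def image_iff)
  show "nondegenerate (circle_sset n) 1 = circle_edge ` {1..n}"
    by (auto simp: nondegenerate_def circle_sset_def circle_edge_def image_iff split: if_splits)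
  have "\<exists>j\<le>m + 1. \<exists>y\<in>simplices (circle_sset n) (m + 1). x = degen (circle_sset n) (m + 1) j y"
    if "x \<in> simplices (circle_sset n) (m + 2)" for x
  proof -
    obtain i t where "x = (i, t)"
      by fastforce
    with that have x: "x = (i, t)" "i \<in> {1..n}" "1 \<le> t" "t \<le> m + 3"
      by (simp_all add: circle_sset_def)
    show ?thesis
    proof (cases "t = 1")
      case True
      with x show ?thesis
        by (intro exI[of _ 1] conjI bexI[of _ "(i, 1)"]) (auto simp: circle_sset_def)
    next
      case False
      with x show ?thesis
        by (intro exI[of _ 0] conjI bexI[of _ "(i, t - 1)"]) (auto simp: circle_sset_def)
    qed
  qed
  note degenerate = this
  have False if x: "x \<in> nondegenerate (circle_sset n) (m + 2)" for x
  proof -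
    from x have "x \<in> simplices (circle_sset n) (m + 2)"
      unfolding nondegenerate_def by blast
    from degenerate[OF this] obtain j y where
      "j \<le> m + 1" "y \<in> simplices (circle_sset n) (m + 1)"
      "x = degen (circle_sset n) (m + 1) j y"
      by blast
    moreover have "m + 2 = Suc (m + 1)"
      by simp
    ultimately show False
      using x unfolding nondegenerate_def by blast
  qed
  then show "nondegenerate (circle_sset n) (m + 2) = {}"
    by blast
qed

lemma circle_distinct: "inj circle_vertex" "inj circle_edge"
  by (auto simp: inj_def circle_vertex_def circle_edge_def)

lemma circle_faces:
  "face (circle_sset n) 1 1 (circle_edge i) = circle_vertex i"
  "i < n \<Longrightarrow> face (circle_sset n) 1 0 (circle_edge i) = face (circle_sset n) 1 1 (circle_edge (i + 1))"
  "face (circle_sset n) 1 0 (circle_edge n) = face (circle_sset n) 1 1 (circle_edge 1)"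
  by (auto simp: circle_sset_def circle_edge_def circle_vertex_def circle_next_def)


section \<open>Cycle distributions\<close>

text \<open>\<open>a i j\<close> stands for $a_i^{(j)}$.\<close>

definition cycle_distribution ::
    "nat \<Rightarrow> nat \<Rightarrow> nat \<Rightarrow> (nat \<Rightarrow> nat \<times> nat \<Rightarrow> nat list pmf) \<Rightarrow> bool" where
  "cycle_distribution n d k p \<longleftrightarrow>
     p \<in> sDist (circle_sset n) (Delta_sset (Zd d)) \<and> 1 \<le> k \<and> k \<le> d \<and>
     (\<exists>a :: nat \<Rightarrow> nat \<Rightarrow> nat.
        (\<forall>i\<in>{1..n}. \<forall>j\<in>{1..k}. a i j \<in> Zd d) \<and>
        (\<forall>i\<in>{1..n}. \<forall>j\<in>{1..k}. \<forall>s\<in>{1..k}. j \<noteq> s \<longrightarrow> a i j \<noteq> a i s) \<and>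
        (\<forall>i\<in>{1..n-1}. \<forall>b\<in>Zd d. \<forall>c\<in>Zd d.
           pmf (p 1 (circle_edge i)) [b, c] =
             (if \<exists>j\<in>{1..k}. b = a i j \<and> c = a (i + 1) j then 1 / real k else 0)) \<and>
        (\<forall>b\<in>Zd d. \<forall>c\<in>Zd d.
           pmf (p 1 (circle_edge n)) [b, c] =
             (if (\<exists>j\<in>{1..k-1}. b = a n j \<and> c = a 1 (j + 1)) \<or> (b = a n k \<and> c = a 1 1)
              then 1 / real k else 0)))"

end

theory Submission
  imports Defs
begin

text \<open>
  A simplicial distribution on the circle is determined by its edge weights, and compatibility with
  the faces says precisely that these weights form a unit flow on the layered digraph with nodes
  \<open>(i, b)\<close>, \<open>i \<in> {1..n}\<close>, and arrows \<open>(i, b) \<rightarrow> (i + 1, c)\<close>, the layers being read modulo \<open>n\<close>.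
  The support of a flow contains a simple directed cycle; a vertex \<open>p\<close> dominates a small multiple of
  the uniform flow on that cycle and hence equals it.  Such a cycle winds \<open>k\<close> times around the
  circle, and for \<open>k = 1\<close> the flow is deterministic.  Conversely, flow conservation makes a uniform
  flow on a simple cycle the only unit flow on its support, so it is a vertex; for \<open>k \<ge> 2\<close> it is not
  deterministic, while every deterministic distribution in a convex decomposition would have its
  support inside that of \<open>p\<close>.
\<close>

subsection \<open>The circle as a space of flows\<close>

text \<open>For an edge \<open>xs\<close> this is the pullback along the monotone map from
  \<open>[m]\<close> to \<open>[1]\<close> sending the first \<open>t\<close> elements to 0,
  matching the encoding \<open>(i, t)\<close> of the circle. The value \<open>t = 0\<close>, which
  encodes no simplex, gives the degenerate simplex at the second vertex.\<close>

definition stretch :: "nat \<Rightarrow> nat \<Rightarrow> 'a list \<Rightarrow> 'a list" where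
  "stretch m t xs = replicate t (xs ! 0) @ replicate (Suc m - t) (xs ! 1)"

lemma length_stretch: "t \<le> Suc m \<Longrightarrow> length (stretch m t xs) = Suc m"
  by (simp add: stretch_def)

lemma nth_stretch: "t \<le> Suc m \<Longrightarrow> k < Suc m \<Longrightarrow> stretch m t xs ! k = xs ! (if k < t then 0 else 1)"
  by (auto simp: stretch_def nth_append)

lemma set_stretch: "length xs = 2 \<Longrightarrow> set (stretch m t xs) \<subseteq> set xs"
  by (auto simp: stretch_def)

text \<open>The index changes as in the faces of \<open>circle_sset\<close>, except that for
  \<open>t = 1\<close> and \<open>j = 0\<close> it drops to 0, where the circle passes to the next
  vertex instead.\<close>

lemma delete_nth_stretch:
  assumes "t \<le> Suc (Suc m)" "j \<le> Suc m"
  shows "delete_nth j (stretch (Suc m) t xs) = stretch m (if j < t then t - 1 else t) xs"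
  using assms
  by (intro nth_equalityI) (auto simp: length_delete_nth length_stretch nth_delete_nth nth_stretch)

lemma repeat_nth_stretch:
  assumes "t \<le> Suc m" "j \<le> m"
  shows "repeat_nth j (stretch m t xs) = stretch (Suc m) (if j < t then t + 1 else t) xs"
  using assms
  by (intro nth_equalityI) (auto simp: length_repeat_nth length_stretch nth_repeat_nth nth_stretch)

lemma stretch_edge: "length xs = 2 \<Longrightarrow> stretch 1 1 xs = xs"
  by (intro nth_equalityI) (auto simp: length_stretch nth_stretch less_Suc_eq)

lemma stretch_full: "stretch m (Suc m) xs = replicate (Suc m) (xs ! 0)"
  by (simp add: stretch_def)

lemma stretch_none: "stretch m 0 xs = replicate (Suc m) (xs ! 1)"
  by (simp add: stretch_def)

section \<open>Push-forwards as finite sums over edges\<close>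

definition edge_lists :: "'a set \<Rightarrow> 'a list set" where
  "edge_lists U = {xs. length xs = 2 \<and> set xs \<subseteq> U}"

lemma edge_lists_eq: "edge_lists U = (\<lambda>(b, c). [b, c]) ` (U \<times> U)"
  by (auto simp: edge_lists_def length_Suc_conv numeral_2_eq_2)

lemma finite_edge_lists: "finite U \<Longrightarrow> finite (edge_lists U)"
  by (simp add: edge_lists_eq)

lemma sum_edge_lists:
  "(\<Sum>xs\<in>edge_lists U. F xs) = (\<Sum>b\<in>U. \<Sum>c\<in>U. F [b, c])"
  unfolding edge_lists_eq
  by (subst sum.reindex) (auto simp: inj_on_def sum.cartesian_product intro!: sum.cong)

text \<open>The index set \<open>S\<close> may exceed the support, so different distributions can be
  summed over the same set.\<close>

lemma pmf_map_pmf_sum: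
  assumes "finite S" "set_pmf p \<subseteq> S"
  shows "pmf (map_pmf f p) y = (\<Sum>x\<in>S. if f x = y then pmf p x else 0)"
proof -
  have "pmf (map_pmf f p) y = measure p (f -` {y} \<inter> set_pmf p)"
    by (simp add: pmf_map measure_Int_set_pmf)
  also have "\<dots> = measure p (f -` {y} \<inter> S)"
    using assms(2) by (intro measure_prob_cong_0) (auto simp: set_pmf_iff)
  also have "\<dots> = (\<Sum>x\<in>f -` {y} \<inter> S. pmf p x)"
    using assms(1) by (simp add: measure_measure_pmf_finite)
  also have "f -` {y} \<inter> S = {x \<in> S. f x = y}"
    by auto
  finally show ?thesis
    using assms(1) by (simp add: sum.inter_filter)
qed

section \<open>Reconstruction of a simplicial distribution from the edges of the circle\<close>

lemma circle_next_in: "i \<in> {1..n} \<Longrightarrow> circle_next n i \<in> {1..n}"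
  by (auto simp: circle_next_def)

lemma sDist_circle_fdist:
  assumes "p \<in> sDist (circle_sset n) (Delta_sset U)" "i \<in> {1..n}" "t \<in> {1..Suc m}"
  shows "p m (i, t) \<in> fdist {xs. length xs = Suc m \<and> set xs \<subseteq> U}"
  using assms by (auto simp: sDist_def simplicial_maps_def dist_sset_def Delta_sset_def circle_sset_def PiE_iff)

lemma sDist_circle_face:
  assumes "p \<in> sDist (circle_sset n) (Delta_sset U)" "i \<in> {1..n}" "t \<in> {1..m + 2}" "j \<le> Suc m"
  shows "p m (face (circle_sset n) (Suc m) j (i, t)) = map_pmf (delete_nth j) (p (Suc m) (i, t))"
proof -
  have "(i, t) \<in> simplices (circle_sset n) (Suc m)"
    using assms by (simp add: circle_sset_def)
  with assms(1,4) show ?thesis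
    unfolding sDist_def simplicial_maps_def dist_sset_def Delta_sset_def by simp
qed

lemma sDist_circle_degen:
  assumes "p \<in> sDist (circle_sset n) (Delta_sset U)" "i \<in> {1..n}" "t \<in> {1..Suc m}" "j \<le> m"
  shows "p (Suc m) (degen (circle_sset n) m j (i, t)) = map_pmf (repeat_nth j) (p m (i, t))"
proof -
  have "(i, t) \<in> simplices (circle_sset n) m"
    using assms by (simp add: circle_sset_def)
  with assms(1,4) show ?thesis
    unfolding sDist_def simplicial_maps_def dist_sset_def Delta_sset_def by simp
qed

lemma sDist_circle_edge_support:
  assumes "p \<in> sDist (circle_sset n) (Delta_sset U)" "i \<in> {1..n}"
  shows "set_pmf (p 1 (circle_edge i)) \<subseteq> edge_lists U"
  using sDist_circle_fdist[OF assms, of 1 1]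
  by (auto simp: fdist_def edge_lists_def circle_edge_def numeral_2_eq_2)

text \<open>Induction on the degree. The vertex is \<open>d_1\<close> of the edge; for
  \<open>t > 1\<close> the simplex \<open>(i, t)\<close> is \<open>s_0\<close> of
  \<open>(i, t - 1)\<close>; above degree 1, \<open>(i, 1)\<close> is the last degeneracy of
  \<open>(i, 1)\<close> one degree lower. Compatibility of \<open>p\<close> with these operators
  gives each case.\<close>

lemma sDist_circle_eq:
  assumes p: "p \<in> sDist (circle_sset n) (Delta_sset U)" and i: "i \<in> {1..n}" and "t \<in> {1..Suc m}"
  shows "p m (i, t) = map_pmf (stretch m t) (p 1 (circle_edge i))"
  using assms(3)
proof (induction m arbitrary: t)
  case 0
  have "p 0 (i, 1) = map_pmf (delete_nth 1) (p 1 (i, 1))"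
    using sDist_circle_face[OF p i, of 1 0 1] by (simp add: circle_sset_def)
  also have "\<dots> = map_pmf (stretch 0 1) (p 1 (circle_edge i))"
    unfolding circle_edge_def
  proof (rule map_pmf_cong[OF refl])
    fix xs assume "xs \<in> set_pmf (p 1 (i, 1))"
    then have "length xs = 2"
      using sDist_circle_edge_support[OF p i] by (auto simp: edge_lists_def circle_edge_def)
    then show "delete_nth 1 xs = stretch 0 1 xs"
      using delete_nth_stretch[of 1 0 1 xs] stretch_edge[of xs] by simp
  qed
  finally show ?case
    using 0 by simp
next
  case (Suc m)
  show ?case
  proof (cases "t = 1")
    case False
    with Suc.prems have t: "t - 1 \<in> {1..Suc m}" "Suc (t - 1) = t" "t - 1 > 0"
      by auto
    have "p (Suc m) (i, t) = map_pmf (repeat_nth 0) (p m (i, t - 1))"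
      using sDist_circle_degen[OF p i t(1), of 0] t by (simp add: circle_sset_def)
    also have "\<dots> = map_pmf (stretch (Suc m) t) (p 1 (circle_edge i))"
      unfolding Suc.IH[OF t(1)] pmf.map_comp
      using t by (intro map_pmf_cong refl) (simp add: repeat_nth_stretch)
    finally show ?thesis .
  next
    case t: True
    show ?thesis
    proof (cases m)
      case 0
      have "map_pmf (stretch 1 1) (p 1 (circle_edge i)) = map_pmf id (p 1 (circle_edge i))"
        using sDist_circle_edge_support[OF p i]
        by (intro map_pmf_cong refl) (auto simp: edge_lists_def stretch_edge simp del: One_nat_def)
      then show ?thesis
        using t 0 by (simp add: circle_edge_def)
    next
      case (Suc m')
      have "p (Suc m) (i, 1) = map_pmf (repeat_nth m) (p m (i, 1))"
        using sDist_circle_degen[OF p i, of 1 m m] Suc by (simp add: circle_sset_def)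
      also have "\<dots> = map_pmf (stretch (Suc m) 1) (p 1 (circle_edge i))"
        using Suc.IH[of 1] Suc unfolding pmf.map_comp
        by (simp add: pmf.map_comp) (intro map_pmf_cong refl, simp add: repeat_nth_stretch)
      finally show ?thesis
        using t by simp
    qed
  qed
qed

lemma sDist_circle_extensional:
  assumes "p \<in> sDist (circle_sset n) (Delta_sset U)" "\<not> (i \<in> {1..n} \<and> t \<in> {1..Suc m})"
  shows "p m (i, t) = undefined"
proof -
  have "p m \<in> extensional ({1..n} \<times> {1..Suc m})"
    using assms(1) by (auto simp: sDist_def simplicial_maps_def circle_sset_def PiE_def)
  moreover have "(i, t) \<notin> {1..n} \<times> {1..Suc m}"
    using assms(2) by blast
  ultimately show ?thesis
    by (rule extensional_arb)
qed

section \<open>Edge weights as unit flows\<close>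

definition edge_weight :: "(nat \<Rightarrow> nat \<times> nat \<Rightarrow> 'a list pmf) \<Rightarrow> nat \<Rightarrow> 'a \<Rightarrow> 'a \<Rightarrow> real" where
  "edge_weight p i b c = pmf (p 1 (circle_edge i)) [b, c]"

definition vertex_weight :: "(nat \<Rightarrow> nat \<times> nat \<Rightarrow> 'a list pmf) \<Rightarrow> nat \<Rightarrow> 'a \<Rightarrow> real" where
  "vertex_weight p i b = pmf (p 0 (circle_vertex i)) [b]"

lemma sDist_circle_eqI:
  assumes p: "p \<in> sDist (circle_sset n) (Delta_sset U)" and q: "q \<in> sDist (circle_sset n) (Delta_sset U)"
    and eq: "\<And>i b c. i \<in> {1..n} \<Longrightarrow> b \<in> U \<Longrightarrow> c \<in> U \<Longrightarrow> edge_weight p i b c = edge_weight q i b c"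
  shows "p = q"
proof -
  have edges: "p 1 (circle_edge i) = q 1 (circle_edge i)" if i: "i \<in> {1..n}" for i
  proof (rule pmf_eqI)
    fix xs
    show "pmf (p 1 (circle_edge i)) xs = pmf (q 1 (circle_edge i)) xs"
    proof (cases "xs \<in> edge_lists U")
      case True
      then show ?thesis
        using eq[OF i] by (auto simp: edge_lists_eq edge_weight_def)
    next
      case False
      then have "xs \<notin> set_pmf (p 1 (circle_edge i))" "xs \<notin> set_pmf (q 1 (circle_edge i))"
        using sDist_circle_edge_support[OF p i] sDist_circle_edge_support[OF q i] by blast+
      then show ?thesis
        by (simp add: set_pmf_iff)
    qed
  qed
  have "p m (i, t) = q m (i, t)" for m i t
  proof (cases "i \<in> {1..n} \<and> t \<in> {1..Suc m}")
    case True
    then show ?thesis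
      using sDist_circle_eq[OF p, of i t m] sDist_circle_eq[OF q, of i t m] edges by simp
  next
    case False
    then show ?thesis
      using sDist_circle_extensional[OF p] sDist_circle_extensional[OF q] by metis
  qed
  then show ?thesis
    by (intro ext) auto
qed

lemma vertex_weight_out:
  assumes p: "p \<in> sDist (circle_sset n) (Delta_sset U)" and i: "i \<in> {1..n}"
    and U: "finite U" "b \<in> U"
  shows "vertex_weight p i b = (\<Sum>c\<in>U. edge_weight p i b c)"
proof -
  have "p 0 (circle_vertex i) = map_pmf (stretch 0 1) (p 1 (circle_edge i))"
    using sDist_circle_eq[OF p i, of 1 0] by (simp add: circle_vertex_def)
  then have "vertex_weight p i b =
      (\<Sum>xs\<in>edge_lists U. if stretch 0 1 xs = [b] then pmf (p 1 (circle_edge i)) xs else 0)"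
    using pmf_map_pmf_sum[OF finite_edge_lists[OF U(1)] sDist_circle_edge_support[OF p i]]
    by (simp add: vertex_weight_def)
  also have "\<dots> = (\<Sum>b'\<in>U. if b' = b then (\<Sum>c\<in>U. edge_weight p i b c) else 0)"
    unfolding sum_edge_lists by (intro sum.cong refl) (auto simp: stretch_def edge_weight_def)
  finally show ?thesis
    using U by simp
qed

text \<open>The face \<open>d_0\<close> of an edge is the next vertex, whose distribution is
  therefore the second marginal of the edge. Together with \<open>vertex_weight_out\<close> this is
  conservation of flow at every node.\<close>

lemma vertex_weight_in:
  assumes p: "p \<in> sDist (circle_sset n) (Delta_sset U)" and i: "i \<in> {1..n}"
    and U: "finite U" "c \<in> U"
  shows "vertex_weight p (circle_next n i) c = (\<Sum>b\<in>U. edge_weight p i b c)"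
proof -
  have "p 0 (circle_vertex (circle_next n i)) = map_pmf (delete_nth 0) (p 1 (circle_edge i))"
    using sDist_circle_face[OF p i, of 1 0 0]
    by (simp add: circle_vertex_def circle_edge_def circle_sset_def)
  then have "vertex_weight p (circle_next n i) c =
      (\<Sum>xs\<in>edge_lists U. if delete_nth 0 xs = [c] then pmf (p 1 (circle_edge i)) xs else 0)"
    using pmf_map_pmf_sum[OF finite_edge_lists[OF U(1)] sDist_circle_edge_support[OF p i]]
    by (simp add: vertex_weight_def)
  also have "\<dots> = (\<Sum>b\<in>U. \<Sum>c'\<in>U. if c' = c then edge_weight p i b c else 0)"
    unfolding sum_edge_lists by (intro sum.cong refl) (auto simp: delete_nth_def edge_weight_def)
  finally show ?thesis
    using U by simp
qed

lemma sum_vertex_weight: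
  assumes p: "p \<in> sDist (circle_sset n) (Delta_sset U)" and i: "i \<in> {1..n}" and U: "finite U"
  shows "(\<Sum>b\<in>U. vertex_weight p i b) = 1"
proof -
  have "(\<Sum>b\<in>U. vertex_weight p i b) = (\<Sum>xs\<in>edge_lists U. pmf (p 1 (circle_edge i)) xs)"
    unfolding sum_edge_lists
    using vertex_weight_out[OF p i U] by (intro sum.cong refl) (simp add: edge_weight_def)
  also have "\<dots> = 1"
    by (intro sum_pmf_eq_1 finite_edge_lists U sDist_circle_edge_support[OF p i])
  finally show ?thesis .
qed

text \<open>Converse of the marginal identities: every unit flow comes from a simplicial
  distribution, obtained by pushing the edge distributions forward along
  \<open>stretch\<close>.\<close>

lemma sDist_circle_exists:
  assumes U: "finite U"
    and nonneg: "\<And>i b c. i \<in> {1..n} \<Longrightarrow> b \<in> U \<Longrightarrow> c \<in> U \<Longrightarrow> 0 \<le> Q i b c"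
    and total: "\<And>i. i \<in> {1..n} \<Longrightarrow> (\<Sum>b\<in>U. \<Sum>c\<in>U. Q i b c) = (1 :: real)"
    and flow: "\<And>i c. i \<in> {1..n} \<Longrightarrow> c \<in> U \<Longrightarrow> (\<Sum>b\<in>U. Q i b c) = (\<Sum>b\<in>U. Q (circle_next n i) c b)"
  obtains q where "q \<in> sDist (circle_sset n) (Delta_sset U)"
    and "\<And>i b c. i \<in> {1..n} \<Longrightarrow> b \<in> U \<Longrightarrow> c \<in> U \<Longrightarrow> edge_weight q i b c = Q i b c"
proof -
  define f where "f i xs = (if xs \<in> edge_lists U then Q i (xs ! 0) (xs ! 1) else 0)" for i xs
  define e where "e i = embed_pmf (f i)" for i
  have pmf_e: "pmf (e i) xs = f i xs" if i: "i \<in> {1..n}" for i xs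
    unfolding e_def
  proof (rule pmf_embed_pmf)
    show f_nonneg: "0 \<le> f i xs" for xs
      using nonneg[OF i] by (auto simp: f_def edge_lists_eq)
    have "(\<integral>\<^sup>+ xs. ennreal (f i xs) \<partial>count_space UNIV) = (\<Sum>xs\<in>edge_lists U. ennreal (f i xs))"
      by (intro nn_integral_count_space' finite_edge_lists U) (auto simp: f_def)
    also have "\<dots> = ennreal (\<Sum>xs\<in>edge_lists U. f i xs)"
      by (rule sum_ennreal) (rule f_nonneg)
    also have "(\<Sum>xs\<in>edge_lists U. f i xs) = (\<Sum>b\<in>U. \<Sum>c\<in>U. Q i b c)"
      unfolding sum_edge_lists by (intro sum.cong refl) (auto simp: f_def edge_lists_def)
    also have "\<dots> = 1"
      by (rule total[OF i])
    finally show "(\<integral>\<^sup>+ xs. ennreal (f i xs) \<partial>count_space UNIV) = 1"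
      by simp
  qed
  have supp_e: "set_pmf (e i) \<subseteq> edge_lists U" if "i \<in> {1..n}" for i
    using that by (auto simp: set_pmf_iff pmf_e f_def split: if_splits)
  \<comment> \<open>Conservation of flow restated as equality of distributions on the shared vertex;
    outside \<open>U\<close> both sides vanish.\<close>
  have marginal: "map_pmf (\<lambda>xs. xs ! 1) (e i) = map_pmf (\<lambda>xs. xs ! 0) (e (circle_next n i))"
    if i: "i \<in> {1..n}" for i
  proof (rule pmf_eqI)
    fix c
    note sums = pmf_map_pmf_sum[OF finite_edge_lists[OF U] supp_e]
    have e: "pmf (e i) [b, c] = Q i b c" if "i \<in> {1..n}" "b \<in> U" "c \<in> U" for i b c
      using that by (simp add: pmf_e f_def edge_lists_def)
    show "pmf (map_pmf (\<lambda>xs. xs ! 1) (e i)) c = pmf (map_pmf (\<lambda>xs. xs ! 0) (e (circle_next n i))) c"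
    proof (cases "c \<in> U")
      case True
      have "pmf (map_pmf (\<lambda>xs. xs ! 1) (e i)) c = (\<Sum>b\<in>U. \<Sum>c'\<in>U. if c' = c then Q i b c else 0)"
        unfolding sums[OF i] sum_edge_lists by (intro sum.cong refl) (auto simp: e[OF i])
      moreover have "pmf (map_pmf (\<lambda>xs. xs ! 0) (e (circle_next n i))) c
          = (\<Sum>c'\<in>U. if c' = c then (\<Sum>b\<in>U. Q (circle_next n i) c b) else 0)"
        unfolding sums[OF circle_next_in[OF i]] sum_edge_lists
        by (intro sum.cong refl) (auto simp: e[OF circle_next_in[OF i]])
      ultimately show ?thesis
        using flow[OF i True] True U by simp
    next
      case False
      then have "c \<notin> (\<lambda>xs. xs ! 1) ` set_pmf (e i)" "c \<notin> (\<lambda>xs. xs ! 0) ` set_pmf (e (circle_next n i))"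
        using supp_e[OF i] supp_e[OF circle_next_in[OF i]] by (auto simp: edge_lists_eq)
      then show ?thesis
        by (metis pmf_eq_0_set_pmf set_map_pmf)
    qed
  qed
  define q where "q m = (\<lambda>(i, t)\<in>{1..n} \<times> {1..Suc m}. map_pmf (stretch m t) (e i))" for m
  have q: "q m (i, t) = map_pmf (stretch m t) (e i)" if "i \<in> {1..n}" "t \<in> {1..Suc m}" for m i t
    unfolding q_def using that by (subst restrict_apply') auto
  have "q \<in> sDist (circle_sset n) (Delta_sset U)"
    unfolding sDist_def simplicial_maps_def
  proof (intro CollectI conjI allI ballI impI)
    fix m
    have "q m (i, t) \<in> fdist {xs. length xs = Suc m \<and> set xs \<subseteq> U}"
      if "i \<in> {1..n}" "t \<in> {1..Suc m}" for i t
    proof -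
      have "stretch m t xs \<in> {xs. length xs = Suc m \<and> set xs \<subseteq> U}" if "xs \<in> set_pmf (e i)" for xs
        using supp_e[OF \<open>i \<in> {1..n}\<close>] that set_stretch[of xs m t] \<open>t \<in> {1..Suc m}\<close>
        by (auto simp: edge_lists_def length_stretch)
      moreover have "finite (set_pmf (e i))"
        using finite_subset[OF supp_e[OF that(1)] finite_edge_lists[OF U]] .
      ultimately show ?thesis
        by (auto simp: q[OF that] fdist_def)
    qed
    then show "q m \<in> simplices (circle_sset n) m \<rightarrow>\<^sub>E simplices (dist_sset (Delta_sset U)) m"
      by (auto simp: circle_sset_def dist_sset_def Delta_sset_def PiE_def q_def extensional_def)
  next
    fix m x j assume x: "x \<in> simplices (circle_sset n) (Suc m)" and j: "j \<le> Suc m"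
    obtain i t where it: "x = (i, t)" "i \<in> {1..n}" "t \<in> {1..Suc (Suc m)}"
      using x by (auto simp: circle_sset_def)
    have D: "map_pmf (delete_nth j) (q (Suc m) x)
        = map_pmf (stretch m (if j < t then t - 1 else t)) (e i)"
      unfolding it(1) q[OF it(2,3)] pmf.map_comp
      using it(3) j by (intro map_pmf_cong refl) (simp add: delete_nth_stretch)
    show "q m (face (circle_sset n) (Suc m) j x) = face (dist_sset (Delta_sset U)) (Suc m) j (q (Suc m) x)"
    \<comment> \<open>Deleting the only element over 0 is the one face that leaves edge
      \<open>i\<close>. It lands on the degenerate simplex at the next vertex, so this is where
      \<open>marginal\<close> enters.\<close>
    proof (cases "j < t \<and> t = 1")
      case True
      have "q m (circle_next n i, Suc m)
          = map_pmf (replicate (Suc m)) (map_pmf (\<lambda>xs. xs ! 0) (e (circle_next n i)))"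
        using q[OF circle_next_in[OF it(2)], of "Suc m" m]
        by (simp add: stretch_full[abs_def] pmf.map_comp comp_def del: replicate.simps)
      also have "\<dots> = map_pmf (stretch m 0) (e i)"
        unfolding marginal[OF it(2), symmetric] pmf.map_comp
        by (simp add: stretch_none[abs_def] comp_def del: replicate.simps)
      finally show ?thesis
        using True D by (simp add: it(1) circle_sset_def dist_sset_def Delta_sset_def)
    next
      case False
      then have "face (circle_sset n) (Suc m) j x = (i, if j < t then t - 1 else t)"
        by (auto simp: it(1) circle_sset_def)
      moreover have "(if j < t then t - 1 else t) \<in> {1..Suc m}"
        using False it(3) j by auto
      ultimately show ?thesis
        using D q[OF it(2)] by (simp add: dist_sset_def Delta_sset_def)
    qed
  next
    fix m x j assume x: "x \<in> simplices (circle_sset n) m" and j: "j \<le> m"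
    obtain i t where it: "x = (i, t)" "i \<in> {1..n}" "t \<in> {1..Suc m}"
      using x by (auto simp: circle_sset_def)
    have "map_pmf (repeat_nth j) (q m x) = map_pmf (stretch (Suc m) (if j < t then t + 1 else t)) (e i)"
      unfolding it(1) q[OF it(2,3)] pmf.map_comp
      using it(3) j by (intro map_pmf_cong refl) (simp add: repeat_nth_stretch)
    moreover have "degen (circle_sset n) m j x = (i, if j < t then t + 1 else t)"
      by (auto simp: it(1) circle_sset_def)
    moreover have "(if j < t then t + 1 else t) \<in> {1..Suc (Suc m)}"
      using it(3) by auto
    ultimately show "q (Suc m) (degen (circle_sset n) m j x) = degen (dist_sset (Delta_sset U)) m j (q m x)"
      using q[OF it(2)] by (simp add: dist_sset_def Delta_sset_def)
  qed
  moreover have "edge_weight q i b c = Q i b c" if "i \<in> {1..n}" "b \<in> U" "c \<in> U" for i b c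
  proof -
    have "q 1 (circle_edge i) = map_pmf (stretch 1 1) (e i)"
      using q[OF that(1), of 1 1] by (simp add: circle_edge_def)
    also have "\<dots> = map_pmf id (e i)"
      using supp_e[OF that(1)]
      by (intro map_pmf_cong refl) (auto simp: edge_lists_def stretch_edge simp del: One_nat_def)
    finally show ?thesis
      using that by (simp add: edge_weight_def pmf_e f_def edge_lists_def)
  qed
  ultimately show thesis
    using that by blast
qed

text \<open>Push-forward is linear in the edge weights, so a linear relation on the edges spreads to
  all simplices.\<close>

lemma sDist_circle_mixture:
  assumes U: "finite U"
    and p: "p \<in> sDist (circle_sset n) (Delta_sset U)"
    and q: "q \<in> sDist (circle_sset n) (Delta_sset U)"
    and q': "q' \<in> sDist (circle_sset n) (Delta_sset U)"
    and mix: "\<And>i b c. i \<in> {1..n} \<Longrightarrow> b \<in> U \<Longrightarrow> c \<in> U \<Longrightarrow>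
      edge_weight p i b c = \<alpha> * edge_weight q i b c + \<beta> * edge_weight q' i b c"
    and x: "x \<in> simplices (circle_sset n) m"
  shows "pmf (p m x) y = \<alpha> * pmf (q m x) y + \<beta> * pmf (q' m x) y"
proof -
  obtain i t where it: "x = (i, t)" "i \<in> {1..n}" "t \<in> {1..Suc m}"
    using x by (auto simp: circle_sset_def)
  have expand: "pmf (r m x) y = (\<Sum>b\<in>U. \<Sum>c\<in>U. if stretch m t [b, c] = y then edge_weight r i b c else 0)"
    if "r \<in> sDist (circle_sset n) (Delta_sset U)" for r
    unfolding it(1) sDist_circle_eq[OF that it(2,3)] edge_weight_def
      pmf_map_pmf_sum[OF finite_edge_lists[OF U] sDist_circle_edge_support[OF that it(2)]] sum_edge_lists
    by (rule refl)
  show ?thesis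
    unfolding expand[OF p] expand[OF q] expand[OF q'] sum_distrib_left sum.distrib[symmetric]
    using mix[OF it(2)] by (intro sum.cong refl) auto
qed

section \<open>Extremality and supports\<close>

lemma finite_positive_lower_bound:
  fixes A :: "real set"
  assumes "finite A"
  obtains \<alpha> where "0 < \<alpha>" "\<alpha> < 1" "\<And>x. x \<in> A \<Longrightarrow> 0 < x \<Longrightarrow> \<alpha> \<le> x"
proof -
  \<comment> \<open>The extra element 1/2 makes \<open>B\<close> nonempty and keeps its minimum
    below 1, so that \<open>1 - \<alpha>\<close> can later be divided by.\<close>
  define B where "B = insert (1/2) {x \<in> A. 0 < x}"
  have B: "finite B" "B \<noteq> {}" "1/2 \<in> B" "\<forall>x\<in>B. 0 < x"
    using assms by (auto simp: B_def)
  show thesis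
  proof (rule that[of "Min B"])
    show "0 < Min B"
      using B by simp
    show "Min B < 1"
      using Min_le[OF B(1,3)] by simp
    show "Min B \<le> x" if "x \<in> A" "0 < x" for x
      by (rule Min_le) (use that B(1) in \<open>simp_all add: B_def\<close>)
  qed
qed

text \<open>If \<open>q\<close> lives on the support of \<open>p\<close>, a small multiple of
  \<open>q\<close> can be subtracted from \<open>p\<close>. The renormalised remainder is again a
  unit flow, so \<open>p\<close> is a proper mixture involving \<open>q\<close>, and extremality
  forces equality.\<close>

lemma is_vertex_circle_unique:
  assumes U: "finite U" and vertex: "is_vertex (circle_sset n) (Delta_sset U) p"
    and q: "q \<in> sDist (circle_sset n) (Delta_sset U)"
    and supp: "\<And>i b c. i \<in> {1..n} \<Longrightarrow> b \<in> U \<Longrightarrow> c \<in> U \<Longrightarrow>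
      edge_weight p i b c = 0 \<Longrightarrow> edge_weight q i b c = 0"
  shows "p = q"
proof -
  have p: "p \<in> sDist (circle_sset n) (Delta_sset U)"
    using vertex by (simp add: is_vertex_def)
  have "finite ((\<lambda>(i, b, c). edge_weight p i b c) ` ({1..n} \<times> U \<times> U))"
    using U by simp
  from finite_positive_lower_bound[OF this] obtain \<alpha> where \<alpha>: "0 < \<alpha>" "\<alpha> < 1"
    and lower: "\<And>x. x \<in> (\<lambda>(i, b, c). edge_weight p i b c) ` ({1..n} \<times> U \<times> U) \<Longrightarrow> 0 < x \<Longrightarrow> \<alpha> \<le> x"
    by metis
  \<comment> \<open>Off the support of \<open>p\<close> both sides are 0; on it,
    \<open>\<alpha>\<close> bounds \<open>p\<close> from below and \<open>q\<close> is at most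
    1.\<close>
  have below: "\<alpha> * edge_weight q i b c \<le> edge_weight p i b c"
    if "i \<in> {1..n}" "b \<in> U" "c \<in> U" for i b c
  proof (cases "edge_weight p i b c = 0")
    case True
    then show ?thesis
      using supp that by simp
  next
    case False
    then have "0 < edge_weight p i b c"
      by (simp add: edge_weight_def)
    then have "\<alpha> \<le> edge_weight p i b c"
      using that by (intro lower) force+
    moreover have "\<alpha> * edge_weight q i b c \<le> \<alpha> * 1"
      using \<alpha> by (intro mult_left_mono) (auto simp: edge_weight_def pmf_le_1)
    ultimately show ?thesis
      by simp
  qed
  \<comment> \<open>The solution of \<open>p = \<alpha> * q + (1 - \<alpha>) * Q\<close> on edge
    weights.\<close>
  define Q where "Q i b c = (edge_weight p i b c - \<alpha> * edge_weight q i b c) / (1 - \<alpha>)" for i b c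
  note Q_sums = Q_def sum_divide_distrib[symmetric] sum_subtractf sum_distrib_left[symmetric]
  have Q_out: "(\<Sum>c\<in>U. Q i b c) = (vertex_weight p i b - \<alpha> * vertex_weight q i b) / (1 - \<alpha>)"
    if "i \<in> {1..n}" "b \<in> U" for i b
    using vertex_weight_out[OF p that(1) U that(2)] vertex_weight_out[OF q that(1) U that(2)]
    by (simp add: Q_sums)
  have Q_in: "(\<Sum>b\<in>U. Q i b c) =
      (vertex_weight p (circle_next n i) c - \<alpha> * vertex_weight q (circle_next n i) c) / (1 - \<alpha>)"
    if "i \<in> {1..n}" "c \<in> U" for i c
    using vertex_weight_in[OF p that(1) U that(2)] vertex_weight_in[OF q that(1) U that(2)]
    by (simp add: Q_sums)
  have nonneg: "0 \<le> Q i b c" if "i \<in> {1..n}" "b \<in> U" "c \<in> U" for i b c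
    using below[OF that] \<alpha> by (simp add: Q_def)
  have total: "(\<Sum>b\<in>U. \<Sum>c\<in>U. Q i b c) = 1" if "i \<in> {1..n}" for i
  proof -
    have "(\<Sum>b\<in>U. \<Sum>c\<in>U. Q i b c)
        = (\<Sum>b\<in>U. (vertex_weight p i b - \<alpha> * vertex_weight q i b) / (1 - \<alpha>))"
      by (intro sum.cong refl Q_out that)
    also have "\<dots> = 1"
      using sum_vertex_weight[OF p that U] sum_vertex_weight[OF q that U] \<alpha>
      by (simp add: sum_divide_distrib[symmetric] sum_subtractf sum_distrib_left[symmetric])
    finally show ?thesis .
  qed
  have flow: "(\<Sum>b\<in>U. Q i b c) = (\<Sum>b\<in>U. Q (circle_next n i) c b)" if "i \<in> {1..n}" "c \<in> U" for i c
    using Q_in[OF that] Q_out[OF circle_next_in[OF that(1)] that(2)] by simp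
  obtain q' where q': "q' \<in> sDist (circle_sset n) (Delta_sset U)"
    and edge_q': "\<And>i b c. i \<in> {1..n} \<Longrightarrow> b \<in> U \<Longrightarrow> c \<in> U \<Longrightarrow> edge_weight q' i b c = Q i b c"
    using sDist_circle_exists[OF U, of n Q] nonneg total flow by blast
  have "pmf (p m x) y = \<alpha> * pmf (q m x) y + (1 - \<alpha>) * pmf (q' m x) y"
    if "x \<in> simplices (circle_sset n) m" for m x y
    using \<alpha> by (intro sDist_circle_mixture[OF U p q q' _ that]) (simp add: edge_q' Q_def del: atLeastAtMost_iff)
  with \<alpha> have "0 < \<alpha> \<and> \<alpha> \<le> 1 \<and> (\<forall>m. \<forall>x\<in>simplices (circle_sset n) m. \<forall>y.
      pmf (p m x) y = \<alpha> * pmf (q m x) y + (1 - \<alpha>) * pmf (q' m x) y)"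
    by simp
  then show ?thesis
    by (rule mp[OF spec[OF bspec[OF bspec[OF conjunct2[OF vertex[unfolded is_vertex_def]] q] q']]])
qed

text \<open>Point masses push forward to point masses and \<open>return_pmf\<close> is injective, so
  the compatibility of \<open>p\<close> with faces and degeneracies descends to
  \<open>\<phi>\<close>.\<close>

lemma sDist_return_pmf_deterministic:
  assumes X: "simplicial_set X" and p: "p \<in> sDist X Y"
    and extensional: "\<And>n. \<phi> n \<in> extensional (simplices X n)"
    and ret: "\<And>n x. x \<in> simplices X n \<Longrightarrow> p n x = return_pmf (\<phi> n x)"
  shows "\<phi> \<in> simplicial_maps X Y" "p = deterministic X \<phi>"
proof -
  show "\<phi> \<in> simplicial_maps X Y"
    unfolding simplicial_maps_def
  proof (intro CollectI conjI allI ballI impI)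
    fix n
    have "return_pmf (\<phi> n x) \<in> fdist (simplices Y n)" if "x \<in> simplices X n" for x
      using p that unfolding ret[OF that, symmetric]
      by (auto simp: sDist_def simplicial_maps_def dist_sset_def PiE_iff)
    then show "\<phi> n \<in> simplices X n \<rightarrow>\<^sub>E simplices Y n"
      using extensional by (auto simp: fdist_def PiE_iff)
  next
    fix n x i assume "x \<in> simplices X (Suc n)" "i \<le> Suc n"
    moreover have "p n (face X (Suc n) i x) = map_pmf (face Y (Suc n) i) (p (Suc n) x)"
      using p calculation by (auto simp: sDist_def simplicial_maps_def dist_sset_def)
    ultimately show "\<phi> n (face X (Suc n) i x) = face Y (Suc n) i (\<phi> (Suc n) x)"
      by (simp add: ret face_closed[OF X])
  next
    fix n x j assume "x \<in> simplices X n" "j \<le> n"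
    moreover have "p (Suc n) (degen X n j x) = map_pmf (degen Y n j) (p n x)"
      using p calculation by (auto simp: sDist_def simplicial_maps_def dist_sset_def)
    ultimately show "\<phi> (Suc n) (degen X n j x) = degen Y n j (\<phi> n x)"
      by (simp add: ret degen_closed[OF X])
  qed
  have "p n x = deterministic X \<phi> n x" for n x
  proof (cases "x \<in> simplices X n")
    case True
    then show ?thesis
      by (simp add: deterministic_def ret)
  next
    case False
    moreover have "p n \<in> extensional (simplices X n)"
      using p by (auto simp: sDist_def simplicial_maps_def PiE_iff)
    ultimately have "p n x = undefined"
      by (metis extensional_arb)
    with False show ?thesis
      by (simp add: deterministic_def)
  qed
  then show "p = deterministic X \<phi>"
    by (intro ext) simp
qed

lemma noncontextual_deterministic:
  assumes "simplicial_set X" "\<phi> \<in> simplicial_maps X Y"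
  shows "noncontextual X Y (deterministic X \<phi>)"
  unfolding noncontextual_def
  using assms by (intro conjI deterministic_in_sDist exI[of _ "{\<phi>}"] exI[of _ "\<lambda>_. 1"]) auto

lemma pmf_eq_1_imp_return_pmf:
  assumes "pmf p x = 1"
  shows "p = return_pmf x"
proof -
  have "measure p {x} = 1"
    using assms by (simp add: pmf.rep_eq)
  then have "set_pmf p \<subseteq> {x}"
    by (subst (asm) measure_pmf.prob_eq_1) (auto simp: AE_measure_pmf_iff)
  then show ?thesis
    by (simp add: set_pmf_subset_singleton)
qed

text \<open>An edge with an entry of weight 1 carries a point mass, hence so do all its stretches,
  and \<open>p\<close> is deterministic. That labels agree at shared vertices is inherited from
  \<open>p\<close>.\<close>

lemma sDist_circle_noncontextualI:
  assumes p: "p \<in> sDist (circle_sset n) (Delta_sset U)"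
    and one: "\<And>i. i \<in> {1..n} \<Longrightarrow> edge_weight p i (u i) (v i) = 1"
  shows "noncontextual (circle_sset n) (Delta_sset U) p"
proof -
  define \<phi> where "\<phi> m = (\<lambda>(i, t)\<in>{1..n} \<times> {1..Suc m}. stretch m t [u i, v i])" for m
  have ret: "p m x = return_pmf (\<phi> m x)" if x: "x \<in> simplices (circle_sset n) m" for m x
  proof -
    obtain i t where it: "x = (i, t)" "i \<in> {1..n}" "t \<in> {1..Suc m}"
      using x by (auto simp: circle_sset_def)
    have "p 1 (circle_edge i) = return_pmf [u i, v i]"
      using one[OF it(2)] by (intro pmf_eq_1_imp_return_pmf) (simp add: edge_weight_def)
    then have "p m x = return_pmf (stretch m t [u i, v i])"
      using sDist_circle_eq[OF p it(2,3)] it(1) by simp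
    also have "stretch m t [u i, v i] = \<phi> m x"
      using it unfolding \<phi>_def by (subst restrict_apply') auto
    finally show ?thesis .
  qed
  have ext: "\<phi> m \<in> extensional (simplices (circle_sset n) m)" for m
    by (simp add: \<phi>_def circle_sset_def)
  note deterministic = sDist_return_pmf_deterministic[OF simplicial_set_circle p ext ret]
  then show ?thesis
    using noncontextual_deterministic[OF simplicial_set_circle] by metis
qed

subsection \<open>Flows along a cycle\<close>

text \<open>\<open>a i j\<close> is the node of layer \<open>i\<close> on the \<open>j\<close>-th turn; crossing layer \<open>n\<close> passes to the next turn.\<close>

definition cycle_succ :: "nat \<Rightarrow> nat \<Rightarrow> (nat \<Rightarrow> nat \<Rightarrow> 'a) \<Rightarrow> nat \<Rightarrow> nat \<Rightarrow> 'a" where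
  "cycle_succ n k a i j = a (circle_next n i) (if i = n then circle_next k j else j)"

text \<open>Injectivity within each layer says that the closed walk visits no node twice.\<close>

definition cycle_labels :: "nat \<Rightarrow> nat \<Rightarrow> 'a set \<Rightarrow> (nat \<Rightarrow> nat \<Rightarrow> 'a) \<Rightarrow> bool" where
  "cycle_labels n k U a \<longleftrightarrow> (\<forall>i\<in>{1..n}. a i ` {1..k} \<subseteq> U \<and> inj_on (a i) {1..k})"

text \<open>The uniform unit flow on the cycle: each of the \<open>k\<close> turns carries
  \<open>1 / k\<close> across every layer.\<close>

definition cycle_weight :: "nat \<Rightarrow> nat \<Rightarrow> (nat \<Rightarrow> nat \<Rightarrow> 'a) \<Rightarrow> nat \<Rightarrow> 'a \<Rightarrow> 'a \<Rightarrow> real" where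
  "cycle_weight n k a i b c =
     (if \<exists>j\<in>{1..k}. b = a i j \<and> c = cycle_succ n k a i j then 1 / real k else 0)"

text \<open>\<open>circle_next\<close> serves both as the shift of the layers and as the cyclic
  shift of the turns; it is used here for the turns.\<close>

lemma bij_betw_circle_next: "bij_betw (circle_next k) {1..k} {1..k}"
proof (rule bij_betwI[where g = "\<lambda>i. if i = 1 then k else i - 1"])
qed (auto simp: circle_next_def Pi_iff split: if_splits)

text \<open>Crossing layer \<open>n\<close> only permutes the turns, so the set of nodes reached is
  unchanged.\<close>

lemma cycle_succ_image:
  "cycle_succ n k a i ` {1..k} = a (circle_next n i) ` {1..k}"
proof (cases "i = n")
  case True
  then have "cycle_succ n k a i ` {1..k} = a (circle_next n i) ` circle_next k ` {1..k}"
    by (simp add: cycle_succ_def image_image)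
  then show ?thesis
    using bij_betw_circle_next[of k] by (simp add: bij_betw_def)
qed (simp add: cycle_succ_def)

lemma inj_on_cycle_succ:
  assumes "cycle_labels n k U a" "i \<in> {1..n}"
  shows "inj_on (cycle_succ n k a i) {1..k}"
proof -
  have inj: "inj_on (a (circle_next n i)) {1..k}"
    using assms circle_next_in[OF assms(2)] by (simp add: cycle_labels_def)
  have "inj_on (a (circle_next n i) \<circ> circle_next k) {1..k}"
    using bij_betw_circle_next[of k] inj by (intro comp_inj_on) (simp_all add: bij_betw_def)
  then show ?thesis
    using inj by (simp add: cycle_succ_def comp_def cong: inj_on_cong) (cases "i = n"; simp)
qed

lemma cycle_labels_in:
  "cycle_labels n k U a \<Longrightarrow> i \<in> {1..n} \<Longrightarrow> j \<in> {1..k} \<Longrightarrow> a i j \<in> U"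
  unfolding cycle_labels_def by blast

lemma cycle_labels_inj:
  "cycle_labels n k U a \<Longrightarrow> i \<in> {1..n} \<Longrightarrow> inj_on (a i) {1..k}"
  by (simp add: cycle_labels_def)

lemma cycle_succ_in:
  assumes "cycle_labels n k U a" "i \<in> {1..n}" "j \<in> {1..k}"
  shows "cycle_succ n k a i j \<in> U"
  using assms cycle_succ_image[of n k a i] circle_next_in[OF assms(2)]
  unfolding cycle_labels_def by blast

text \<open>Injectivity of \<open>f\<close> leaves at most one index over \<open>b\<close>, so the
  row of \<open>b\<close> has at most one nonzero entry. Exchanging \<open>f\<close> and
  \<open>g\<close> gives the statement for columns.\<close>

lemma sum_graph_fst:
  assumes "finite U" "inj_on f J" "g ` J \<subseteq> U"
  shows "(\<Sum>c\<in>U. if \<exists>j\<in>J. b = f j \<and> c = g j then w else (0 :: real)) = (if b \<in> f ` J then w else 0)"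
proof (cases "b \<in> f ` J")
  case True
  then obtain j where j: "b = f j" "j \<in> J"
    by blast
  then have "(\<exists>j\<in>J. b = f j \<and> c = g j) \<longleftrightarrow> c = g j" for c
    using assms(2) by (auto dest: inj_onD)
  then show ?thesis
    using assms j by auto
next
  case False
  then have "\<not> (\<exists>j\<in>J. b = f j \<and> c = g j)" for c
    by blast
  with False show ?thesis
    by (simp only: if_False sum.neutral_const)
qed

lemma cycle_weight_out:
  assumes "finite U" "cycle_labels n k U a" "i \<in> {1..n}"
  shows "(\<Sum>c\<in>U. cycle_weight n k a i b c) = (if b \<in> a i ` {1..k} then 1 / real k else 0)"
  unfolding cycle_weight_def using assms cycle_succ_in[OF assms(2,3)]
  by (intro sum_graph_fst) (auto simp: cycle_labels_def)

lemma cycle_weight_in: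
  assumes "finite U" "cycle_labels n k U a" "i \<in> {1..n}"
  shows "(\<Sum>b\<in>U. cycle_weight n k a i b c) =
    (if c \<in> a (circle_next n i) ` {1..k} then 1 / real k else 0)"
proof -
  have "(\<Sum>b\<in>U. cycle_weight n k a i b c) =
      (\<Sum>b\<in>U. if \<exists>j\<in>{1..k}. c = cycle_succ n k a i j \<and> b = a i j then 1 / real k else 0)"
    unfolding cycle_weight_def by (intro sum.cong refl if_cong) auto
  also have "\<dots> = (if c \<in> cycle_succ n k a i ` {1..k} then 1 / real k else 0)"
    using assms inj_on_cycle_succ[OF assms(2,3)]
    by (intro sum_graph_fst) (auto simp: cycle_labels_def)
  finally show ?thesis
    unfolding cycle_succ_image .
qed

text \<open>Inflow and outflow at a node are both \<open>1 / k\<close> on the cycle and 0 off it,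
  which gives conservation; each layer meets the cycle in \<open>k\<close> nodes, which gives total
  1.\<close>

lemma sDist_cycle_exists:
  assumes U: "finite U" and k: "1 \<le> k" and a: "cycle_labels n k U a"
  obtains q where "q \<in> sDist (circle_sset n) (Delta_sset U)"
    and "\<And>i b c. i \<in> {1..n} \<Longrightarrow> b \<in> U \<Longrightarrow> c \<in> U \<Longrightarrow> edge_weight q i b c = cycle_weight n k a i b c"
proof (rule sDist_circle_exists[OF U, of n "cycle_weight n k a"])
  show "0 \<le> cycle_weight n k a i b c" for i b c
    by (simp add: cycle_weight_def)
  show "(\<Sum>b\<in>U. \<Sum>c\<in>U. cycle_weight n k a i b c) = 1" if i: "i \<in> {1..n}" for i
  proof -
    have "(\<Sum>b\<in>U. \<Sum>c\<in>U. cycle_weight n k a i b c) = (\<Sum>b\<in>a i ` {1..k}. 1 / real k)"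
      unfolding cycle_weight_out[OF U a i]
      using U a i by (intro sum.mono_neutral_cong_right) (auto simp: cycle_labels_def)
    also have "\<dots> = 1"
      using a i k by (simp add: cycle_labels_def card_image)
    finally show ?thesis .
  qed
  show "(\<Sum>b\<in>U. cycle_weight n k a i b c) = (\<Sum>b\<in>U. cycle_weight n k a (circle_next n i) c b)"
    if i: "i \<in> {1..n}" for i c
    using cycle_weight_in[OF U a i] cycle_weight_out[OF U a circle_next_in[OF i]] by simp
qed (use that in blast)

text \<open>The separate clauses for edge \<open>n\<close> and for turn \<open>k\<close> in
  \<open>cycle_distribution\<close> are the wrap-around cases of \<open>cycle_succ\<close>. For
  \<open>k = 0\<close> both sides are false.\<close>

lemma cycle_distribution_iff:
  assumes "1 \<le> n" "p \<in> sDist (circle_sset n) (Delta_sset (Zd d))"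
  shows "cycle_distribution n d k p \<longleftrightarrow> 1 \<le> k \<and> k \<le> d \<and>
    (\<exists>a. cycle_labels n k (Zd d) a \<and>
      (\<forall>i\<in>{1..n}. \<forall>b\<in>Zd d. \<forall>c\<in>Zd d. edge_weight p i b c = cycle_weight n k a i b c))"
proof (cases "1 \<le> k")
  case k: True
  have labels: "cycle_labels n k (Zd d) a \<longleftrightarrow>
      (\<forall>i\<in>{1..n}. \<forall>j\<in>{1..k}. a i j \<in> Zd d) \<and>
      (\<forall>i\<in>{1..n}. \<forall>j\<in>{1..k}. \<forall>s\<in>{1..k}. j \<noteq> s \<longrightarrow> a i j \<noteq> a i s)" for a :: "nat \<Rightarrow> nat \<Rightarrow> nat"
    unfolding cycle_labels_def inj_on_def by blast
  have inner: "cycle_weight n k a i b c =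
      (if \<exists>j\<in>{1..k}. b = a i j \<and> c = a (i + 1) j then 1 / real k else 0)" if "i \<in> {1..n-1}" for a :: "nat \<Rightarrow> nat \<Rightarrow> nat" and i b c
    using that by (auto simp: cycle_weight_def cycle_succ_def circle_next_def)
  have "(\<exists>j\<in>{1..k}. b = a n j \<and> c = cycle_succ n k a n j) \<longleftrightarrow>
      (\<exists>j\<in>{1..k-1}. b = a n j \<and> c = a 1 (j + 1)) \<or> (b = a n k \<and> c = a 1 1)" for a :: "nat \<Rightarrow> nat \<Rightarrow> nat" and b c
  proof -
    have "{1..k} = insert k {1..k-1}"
      using k by auto
    moreover have "cycle_succ n k a n k = a 1 1"
      by (simp add: cycle_succ_def circle_next_def)
    moreover have "cycle_succ n k a n j = a 1 (j + 1)" if "j \<in> {1..k-1}" for j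
      using that k by (auto simp: cycle_succ_def circle_next_def)
    ultimately show ?thesis
      by (metis insert_iff)
  qed
  then have last: "cycle_weight n k a n b c =
      (if (\<exists>j\<in>{1..k-1}. b = a n j \<and> c = a 1 (j + 1)) \<or> (b = a n k \<and> c = a 1 1)
       then 1 / real k else 0)" for a :: "nat \<Rightarrow> nat \<Rightarrow> nat" and b c
    by (simp only: cycle_weight_def)
  have split: "{1..n} = insert n {1..n-1}"
    using assms(1) by auto
  have "(\<forall>i\<in>{1..n}. \<forall>b\<in>Zd d. \<forall>c\<in>Zd d. edge_weight p i b c = cycle_weight n k a i b c) \<longleftrightarrow>
      (\<forall>i\<in>{1..n-1}. \<forall>b\<in>Zd d. \<forall>c\<in>Zd d. pmf (p 1 (circle_edge i)) [b, c] =
         (if \<exists>j\<in>{1..k}. b = a i j \<and> c = a (i + 1) j then 1 / real k else 0)) \<and>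
      (\<forall>b\<in>Zd d. \<forall>c\<in>Zd d. pmf (p 1 (circle_edge n)) [b, c] =
         (if (\<exists>j\<in>{1..k-1}. b = a n j \<and> c = a 1 (j + 1)) \<or> (b = a n k \<and> c = a 1 1)
          then 1 / real k else 0))" for a :: "nat \<Rightarrow> nat \<Rightarrow> nat"
    unfolding split using inner last
    by (simp add: edge_weight_def conj_commute del: atLeastAtMost_iff cong: ball_cong)
  then show ?thesis
    unfolding cycle_distribution_def labels using assms(2) by (simp only: conj_assoc simp_thms)
qed (auto simp: cycle_distribution_def)

text \<open>A flow supported on a simple cycle has one arrow into and one out of each node, so
  conservation makes it constant along the cycle. The total 1 over the \<open>k\<close> nodes of
  layer 1 fixes the constant.\<close>

lemma cycle_unique:
  assumes U: "finite U" and n: "1 \<le> n" and k: "1 \<le> k" and a: "cycle_labels n k U a"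
    and q: "q \<in> sDist (circle_sset n) (Delta_sset U)"
    and supp: "\<And>i b c. i \<in> {1..n} \<Longrightarrow> b \<in> U \<Longrightarrow> c \<in> U \<Longrightarrow>
      cycle_weight n k a i b c = 0 \<Longrightarrow> edge_weight q i b c = 0"
    and i: "i \<in> {1..n}" and "b \<in> U" "c \<in> U"
  shows "edge_weight q i b c = cycle_weight n k a i b c"
proof -
  define w where "w i j = edge_weight q i (a i j) (cycle_succ n k a i j)" for i j
  have in_U: "a i j \<in> U" if "i \<in> {1..n}" "j \<in> {1..k}" for i j
    by (rule cycle_labels_in[OF a that])
  have inj: "j = j'" if "i \<in> {1..n}" "j \<in> {1..k}" "j' \<in> {1..k}" "a i j = a i j'" for i j j'
    using inj_onD[OF cycle_labels_inj[OF a that(1)] that(4,2,3)] .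
  have zero: "edge_weight q i b c = 0"
    if "i \<in> {1..n}" "b \<in> U" "c \<in> U" "\<not> (\<exists>j\<in>{1..k}. b = a i j \<and> c = cycle_succ n k a i j)" for i b c
    using that by (intro supp) (simp_all only: cycle_weight_def if_False)
  \<comment> \<open>As \<open>a i\<close> is injective, only one arrow leaving this node can carry
    flow; dually for \<open>inn\<close>, by injectivity of \<open>cycle_succ\<close>.\<close>
  have out: "vertex_weight q i (a i j) = w i j" if ij: "i \<in> {1..n}" "j \<in> {1..k}" for i j
  proof -
    have "vertex_weight q i (a i j) = (\<Sum>c\<in>U. if c = cycle_succ n k a i j then w i j else 0)"
      unfolding vertex_weight_out[OF q ij(1) U in_U[OF ij]]
    proof (intro sum.cong refl)
      fix c assume "c \<in> U"
      then show "edge_weight q i (a i j) c = (if c = cycle_succ n k a i j then w i j else 0)"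
      proof (cases "c = cycle_succ n k a i j")
        case False
        then have "\<not> (\<exists>j'\<in>{1..k}. a i j = a i j' \<and> c = cycle_succ n k a i j')"
          using inj[OF ij] by blast
        from zero[OF ij(1) in_U[OF ij] \<open>c \<in> U\<close> this] False show ?thesis
          by simp
      qed (simp add: w_def)
    qed
    then show ?thesis
      using U cycle_succ_in[OF a ij] by simp
  qed
  have inn: "vertex_weight q (circle_next n i) (cycle_succ n k a i j) = w i j"
    if ij: "i \<in> {1..n}" "j \<in> {1..k}" for i j
  proof -
    have "vertex_weight q (circle_next n i) (cycle_succ n k a i j) = (\<Sum>b\<in>U. if b = a i j then w i j else 0)"
      unfolding vertex_weight_in[OF q ij(1) U cycle_succ_in[OF a ij]]
    proof (intro sum.cong refl)
      fix b assume "b \<in> U"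
      then show "edge_weight q i b (cycle_succ n k a i j) = (if b = a i j then w i j else 0)"
      proof (cases "b = a i j")
        case False
        then have "\<not> (\<exists>j'\<in>{1..k}. b = a i j' \<and> cycle_succ n k a i j = cycle_succ n k a i j')"
          using inj_onD[OF inj_on_cycle_succ[OF a ij(1)]] ij(2) by blast
        from zero[OF ij(1) \<open>b \<in> U\<close> cycle_succ_in[OF a ij] this] False show ?thesis
          by simp
      qed (simp add: w_def)
    qed
    then show ?thesis
      using U in_U[OF ij] by simp
  qed
  \<comment> \<open>Inflow equals outflow at the node reached, so consecutive arrows carry the same
    weight. Then \<open>along\<close> follows a turn through the layers and \<open>around\<close>
    passes from one turn to the next.\<close>
  have advance: "w (circle_next n i) (if i = n then circle_next k j else j) = w i j"
    if ij: "i \<in> {1..n}" "j \<in> {1..k}" for i j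
    using inn[OF ij] out[OF circle_next_in[OF ij(1)], of "if i = n then circle_next k j else j"]
      ij(2) circle_next_in[of j k] by (auto simp: cycle_succ_def)
  have along: "w i j = w 1 j" if "i \<in> {1..n}" "j \<in> {1..k}" for i j
  proof -
    have "1 \<le> i" "i \<le> n"
      using that(1) by auto
    then show ?thesis
    proof (induction i rule: dec_induct)
      case (step i)
      then show ?case
        using \<open>j \<in> {1..k}\<close> advance[of i j]
        by (simp add: circle_next_def)
    qed simp
  qed
  have around: "w 1 j = w 1 1" if "j \<in> {1..k}" for j
  proof -
    have "1 \<le> j" "j \<le> k"
      using that by auto
    then show ?thesis
    proof (induction j rule: dec_induct)
      case (step j)
      have "w 1 (Suc j) = w n j"
        using advance[of n j] step n
        by (simp add: circle_next_def)
      then show ?case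
        using along[of n j] step n by simp
    qed simp
  qed
  have one: "1 \<in> {1..n}"
    using n by simp
  have "1 = (\<Sum>b\<in>U. vertex_weight q 1 b)"
    by (rule sum_vertex_weight[OF q one U, symmetric])
  also have "\<dots> = (\<Sum>b\<in>a 1 ` {1..k}. vertex_weight q 1 b)"
  proof (rule sum.mono_neutral_right[OF U])
    show "a 1 ` {1..k} \<subseteq> U"
      using a one by (simp add: cycle_labels_def)
    show "\<forall>b\<in>U - a 1 ` {1..k}. vertex_weight q 1 b = 0"
    proof
      fix b assume b: "b \<in> U - a 1 ` {1..k}"
      then show "vertex_weight q 1 b = 0"
        using zero[OF one] by (subst vertex_weight_out[OF q one U]) (auto intro!: sum.neutral)
    qed
  qed
  also have "\<dots> = (\<Sum>j\<in>{1..k}. vertex_weight q 1 (a 1 j))"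
    using a one by (simp add: cycle_labels_def sum.reindex)
  also have "\<dots> = (\<Sum>j\<in>{1..k}. w 1 1)"
    using out[OF one] around by (intro sum.cong refl) (simp del: atLeastAtMost_iff)
  finally have "w 1 1 = 1 / real k"
    using k by (simp add: field_simps)
  then have "w i j = 1 / real k" if "j \<in> {1..k}" for j
    using along[OF i that] around[OF that] by simp
  then show ?thesis
    using zero[OF i \<open>b \<in> U\<close> \<open>c \<in> U\<close>] by (auto simp: cycle_weight_def w_def)
qed

subsection \<open>Cycles in the support of a flow\<close>

text \<open>Two iterates of \<open>x\<close> coincide by finiteness, so a later point
  \<open>y\<close> of the orbit is periodic, and its least period is \<open>k\<close>. The range
  \<open>{1..k}\<close> fits the numbering of turns.\<close>

lemma finite_orbit_period:
  assumes "finite S" "G \<in> S \<rightarrow> S" "x \<in> S"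
  obtains y k where "y \<in> S" "1 \<le> k" "(G ^^ k) y = y" "inj_on (\<lambda>j. (G ^^ j) y) {1..k}"
proof -
  have in_S: "(G ^^ m) x \<in> S" for m
    using assms(2,3) by (induction m) auto
  then have "\<not> inj (\<lambda>m. (G ^^ m) x)"
    using assms(1) by (meson finite_subset image_subsetI range_inj_infinite)
  then obtain l m where "l < m" "(G ^^ l) x = (G ^^ m) x"
    unfolding inj_def by (metis linorder_neqE_nat)
  define y where "y = (G ^^ l) x"
  have "(G ^^ (m - l)) y = (G ^^ (m - l + l)) x"
    unfolding y_def funpow_add by simp
  then have ex: "0 < m - l \<and> (G ^^ (m - l)) y = y"
    using \<open>l < m\<close> \<open>(G ^^ l) x = (G ^^ m) x\<close> by (simp add: y_def)
  define k where "k = (LEAST k. 0 < k \<and> (G ^^ k) y = y)"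
  have k: "0 < k \<and> (G ^^ k) y = y"
    unfolding k_def by (rule LeastI) (rule ex)
  have least: "k \<le> k'" if "0 < k'" "(G ^^ k') y = y" for k'
    unfolding k_def using that by (intro Least_le) auto
  have "(G ^^ i) y \<noteq> (G ^^ j) y" if "0 < i" "i < j" "j \<le> k" for i j
  proof
    assume "(G ^^ i) y = (G ^^ j) y"
    \<comment> \<open>Applying the remaining \<open>k - j\<close> iterations turns a coincidence
      into the period \<open>k - j + i\<close>, smaller than \<open>k\<close>.\<close>
    then have "(G ^^ (k - j + i)) y = (G ^^ (k - j + j)) y"
      unfolding funpow_add by simp
    then have "(G ^^ (k - j + i)) y = y"
      using that k by simp
    with least[of "k - j + i"] that show False
      by simp
  qed
  then have "inj_on (\<lambda>j. (G ^^ j) y) {1..k}"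
    by (intro linorder_inj_onI') auto
  with k in_S show thesis
    by (intro that[of y k]) (auto simp: y_def)
qed

text \<open>The turns of the cycle are a periodic orbit of the first-return map to layer 1.\<close>

lemma cycle_in_support:
  assumes U: "finite U" and n: "1 \<le> n" and p: "p \<in> sDist (circle_sset n) (Delta_sset U)"
  obtains k a where "1 \<le> k" "cycle_labels n k U a"
    and "\<And>i j. i \<in> {1..n} \<Longrightarrow> j \<in> {1..k} \<Longrightarrow> 0 < edge_weight p i (a i j) (cycle_succ n k a i j)"
proof -
  \<comment> \<open>A choice of outgoing arrow with positive weight. By conservation its target has
    positive weight too, so the walk can always be continued.\<close>
  define f where "f i b = (SOME c. c \<in> U \<and> 0 < edge_weight p i b c)" for i b
  have f: "f i b \<in> U" "0 < edge_weight p i b (f i b)" "0 < vertex_weight p (circle_next n i) (f i b)"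
    if i: "i \<in> {1..n}" and b: "b \<in> U" "0 < vertex_weight p i b" for i b
  proof -
    have "\<exists>c. c \<in> U \<and> 0 < edge_weight p i b c"
      using b vertex_weight_out[OF p i U b(1)] by (metis less_le_not_le linorder_not_le sum_nonpos)
    then have "f i b \<in> U \<and> 0 < edge_weight p i b (f i b)"
      unfolding f_def by (rule someI_ex)
    then show *: "f i b \<in> U" "0 < edge_weight p i b (f i b)"
      by auto
    have "0 < (\<Sum>b'\<in>U. edge_weight p i b' (f i b))"
      using U b(1) * by (intro sum_pos2[of U b]) (auto simp: edge_weight_def)
    then show "0 < vertex_weight p (circle_next n i) (f i b)"
      using vertex_weight_in[OF p i U *(1)] by simp
  qed
  \<comment> \<open>\<open>h m\<close> follows the chosen arrows from layer 1 through
    \<open>m\<close> steps, so \<open>h n\<close> is the first-return map.\<close>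
  define h where "h m = fold f [1..<Suc m]" for m
  have h_0: "h 0 b = b" and h_Suc: "h (Suc m) b = f (Suc m) (h m b)" for m b
    by (simp_all add: h_def)
  define S where "S = {b \<in> U. 0 < vertex_weight p 1 b}"
  have h_in: "h m b \<in> U \<and> 0 < vertex_weight p (Suc m) (h m b)" if "b \<in> S" "m < n" for m b
    using that(2)
  proof (induction m)
    case 0
    then show ?case
      using that(1) by (simp add: h_0 S_def)
  next
    case (Suc m)
    then show ?case
      using f[of "Suc m" "h m b"] by (auto simp: h_Suc circle_next_def)
  qed
  have h_pos: "0 < edge_weight p i (h (i - 1) b) (h i b)" if "b \<in> S" "i \<in> {1..n}" for i b
    using h_in[OF that(1), of "i - 1"] f(2)[OF that(2)] that(2) h_Suc[of "i - 1" b] by auto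
  have G: "h n \<in> S \<rightarrow> S"
  proof
    fix b assume "b \<in> S"
    then show "h n b \<in> S"
      using h_in[of b "n - 1"] f[of n "h (n - 1) b"] n h_Suc[of "n - 1" b]
      by (auto simp: S_def circle_next_def)
  qed
  have "\<exists>b\<in>U. 0 < vertex_weight p 1 b"
  proof (rule ccontr)
    assume "\<not> ?thesis"
    then have "(\<Sum>b\<in>U. vertex_weight p 1 b) \<le> 0"
      by (intro sum_nonpos) auto
    then show False
      using sum_vertex_weight[OF p _ U, of 1] n by simp
  qed
  then obtain x where "x \<in> S"
    by (auto simp: S_def)
  moreover have "finite S"
    using U by (simp add: S_def)
  ultimately obtain y k where y: "y \<in> S" and k: "1 \<le> k" "(h n ^^ k) y = y"
    and inj: "inj_on (\<lambda>j. (h n ^^ j) y) {1..k}"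
    using finite_orbit_period[OF _ G] by metis
  \<comment> \<open>Turn \<open>j\<close> starts at the orbit point with exponent
    \<open>j - 1\<close>, and layer \<open>i\<close> is reached after \<open>i - 1\<close>
    steps.\<close>
  define a where "a i j = h (i - 1) ((h n ^^ (j - 1)) y)" for i j
  have orbit: "(h n ^^ j) y \<in> S" for j
    using y G by (induction j) auto
  have first_return: "h n ((h n ^^ (j - 1)) y) = (h n ^^ j) y" if "j \<in> {1..k}" for j
    using that by (cases j) auto
  show thesis
  proof (rule that[OF k(1), of a])
    have "a i ` {1..k} \<subseteq> U" if "i \<in> {1..n}" for i
      using h_in[OF orbit] that by (auto simp: a_def)
    moreover have "inj_on (a i) {1..k}" if i: "i \<in> {1..n}" for i
    proof (rule inj_onI)
      fix j s assume js: "j \<in> {1..k}" "s \<in> {1..k}" "a i j = a i s"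
      \<comment> \<open>Two turns that meet in some layer stay together, hence return to the same
        orbit point; injectivity on the orbit then identifies the turns.\<close>
      have later: "h m b = h m b'" if "i - 1 \<le> m" "h (i - 1) b = h (i - 1) b'" for m b b'
        using that by (induction m rule: dec_induct) (simp_all add: h_Suc)
      have "h n ((h n ^^ (j - 1)) y) = h n ((h n ^^ (s - 1)) y)"
        by (rule later) (use i js(3) in \<open>auto simp: a_def\<close>)
      then have "(h n ^^ j) y = (h n ^^ s) y"
        unfolding first_return[OF js(1)] first_return[OF js(2)] .
      then show "j = s"
        by (rule inj_onD[OF inj _ js(1,2)])
    qed
    ultimately show "cycle_labels n k U a"
      by (simp add: cycle_labels_def)
    fix i j assume ij: "i \<in> {1..n}" "j \<in> {1..k}"
    have "cycle_succ n k a i j = h i ((h n ^^ (j - 1)) y)"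
    proof (cases "i = n")
      case True
      \<comment> \<open>For \<open>j = k\<close> the left exponent is 0, and the two sides agree
        because \<open>y\<close> has period \<open>k\<close>.\<close>
      have "(h n ^^ (circle_next k j - 1)) y = (h n ^^ j) y"
        using k by (auto simp: circle_next_def)
      then show ?thesis
        using True first_return[OF ij(2)] by (simp add: cycle_succ_def a_def circle_next_def h_0)
    next
      case False
      then show ?thesis
        by (simp add: cycle_succ_def a_def circle_next_def)
    qed
    then show "0 < edge_weight p i (a i j) (cycle_succ n k a i j)"
      using h_pos[OF orbit ij(1)] by (simp add: a_def)
  qed
qed

section \<open>Contextual vertices and cycle distributions: the two implications\<close>

theorem theorem4p4:
  fixes n d :: nat and p :: "nat \<Rightarrow> nat \<times> nat \<Rightarrow> nat list pmf"
  assumes "1 \<le> n" and "1 \<le> d"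
    and "p \<in> sDist (circle_sset n) (Delta_sset (Zd d))"
  shows "contextual (circle_sset n) (Delta_sset (Zd d)) p \<and>
           is_vertex (circle_sset n) (Delta_sset (Zd d)) p \<longleftrightarrow>
         (\<exists>k\<ge>2. cycle_distribution n d k p)"
proof
  note n = assms(1) and p = assms(3)
  have U: "finite (Zd d)"
    by (simp add: Zd_def)
  {
    assume vertex: "contextual (circle_sset n) (Delta_sset (Zd d)) p \<and>
      is_vertex (circle_sset n) (Delta_sset (Zd d)) p"
    obtain k a where k: "1 \<le> k" and a: "cycle_labels n k (Zd d) a"
      and pos: "\<And>i j. i \<in> {1..n} \<Longrightarrow> j \<in> {1..k} \<Longrightarrow> 0 < edge_weight p i (a i j) (cycle_succ n k a i j)"
      using cycle_in_support[OF U n p] by metis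
    obtain q where q: "q \<in> sDist (circle_sset n) (Delta_sset (Zd d))"
      and edge_q: "\<And>i b c. i \<in> {1..n} \<Longrightarrow> b \<in> Zd d \<Longrightarrow> c \<in> Zd d \<Longrightarrow>
        edge_weight q i b c = cycle_weight n k a i b c"
      using sDist_cycle_exists[OF U k a] by metis
    \<comment> \<open>The arrows of the cycle all have positive weight in \<open>p\<close>, so the
      cycle flow \<open>q\<close> is supported inside \<open>p\<close>.\<close>
    have "p = q"
    proof (rule is_vertex_circle_unique[OF U _ q])
      fix i b c assume "i \<in> {1..n}" "b \<in> Zd d" "c \<in> Zd d" "edge_weight p i b c = 0"
      then show "edge_weight q i b c = 0"
        using pos[of i] edge_q[of i b c] unfolding cycle_weight_def by (metis less_irrefl)
    qed (use vertex in blast)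
    note edge_p = edge_q[folded this]
    have a_in: "a i j \<in> Zd d" if "i \<in> {1..n}" "j \<in> {1..k}" for i j
      by (rule cycle_labels_in[OF a that])
    have "k \<noteq> 1"
    \<comment> \<open>A single turn puts weight 1 on one arrow of every edge, which would make
      \<open>p\<close> noncontextual.\<close>
    proof
      assume k1: "k = 1"
      have "edge_weight p i (a i 1) (cycle_succ n k a i 1) = 1" if "i \<in> {1..n}" for i
        using edge_p[OF that a_in[OF that, of 1] cycle_succ_in[OF a that, of 1]] k1
        by (simp add: cycle_weight_def)
      from sDist_circle_noncontextualI[OF p this] vertex show False
        by (simp add: contextual_def)
    qed
    moreover have "k \<le> d"
    proof -
      \<comment> \<open>The \<open>k\<close> turns meet layer 1 in distinct elements of
        \<open>Zd d\<close>.\<close>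
      have "card (a 1 ` {1..k}) \<le> card (Zd d)"
        using a n U by (intro card_mono) (auto simp: cycle_labels_def)
      then show ?thesis
        using a n by (simp add: cycle_labels_def card_image Zd_def)
    qed
    ultimately show "\<exists>k\<ge>2. cycle_distribution n d k p"
      using k a edge_p by (intro exI[of _ k]) (auto simp: cycle_distribution_iff[OF n p])
  }
  {
    assume "\<exists>k\<ge>2. cycle_distribution n d k p"
    then obtain k a where k: "2 \<le> k" and a: "cycle_labels n k (Zd d) a"
      and edge_p: "\<And>i b c. i \<in> {1..n} \<Longrightarrow> b \<in> Zd d \<Longrightarrow> c \<in> Zd d \<Longrightarrow>
        edge_weight p i b c = cycle_weight n k a i b c"
      unfolding cycle_distribution_iff[OF n p] by metis
    \<comment> \<open>Rigidity of the support of \<open>p\<close>; both extremality and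
      contextuality follow from it.\<close>
    have unique: "q = p" if q: "q \<in> sDist (circle_sset n) (Delta_sset (Zd d))"
      and "\<And>i b c. i \<in> {1..n} \<Longrightarrow> b \<in> Zd d \<Longrightarrow> c \<in> Zd d \<Longrightarrow>
        edge_weight p i b c = 0 \<Longrightarrow> edge_weight q i b c = 0" for q
      using that(2) cycle_unique[OF U n _ a q] k by (intro sDist_circle_eqI[OF q p]) (simp add: edge_p del: atLeastAtMost_iff)
    have edge: "circle_edge i \<in> simplices (circle_sset n) 1" if "i \<in> {1..n}" for i
      using that by (simp add: circle_edge_def circle_sset_def)
    have "is_vertex (circle_sset n) (Delta_sset (Zd d)) p"
      unfolding is_vertex_def
    proof (intro conjI ballI allI impI p, elim conjE)
      fix q q' :: "nat \<Rightarrow> nat \<times> nat \<Rightarrow> nat list pmf" and \<alpha> :: real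
      assume q: "q \<in> sDist (circle_sset n) (Delta_sset (Zd d))"
        and \<alpha>: "0 < \<alpha>" "\<alpha> \<le> 1"
        and mix: "\<forall>m. \<forall>x\<in>simplices (circle_sset n) m. \<forall>y.
          pmf (p m x) y = \<alpha> * pmf (q m x) y + (1 - \<alpha>) * pmf (q' m x) y"
      have "q = p"
      proof (rule unique[OF q])
        fix i b c assume i: "i \<in> {1..n}" and "edge_weight p i b c = 0"
        then have "\<alpha> * edge_weight q i b c + (1 - \<alpha>) * edge_weight q' i b c = 0"
          using mix edge[OF i] by (simp add: edge_weight_def)
        \<comment> \<open>A vanishing sum of nonnegative terms has vanishing terms, so positivity of
          \<open>\<alpha>\<close> puts the support of \<open>q\<close> inside that of
          \<open>p\<close>.\<close>
        moreover have "0 \<le> \<alpha> * edge_weight q i b c" "0 \<le> (1 - \<alpha>) * edge_weight q' i b c"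
          using \<alpha> by (simp_all add: edge_weight_def)
        ultimately have "\<alpha> * edge_weight q i b c = 0"
          by linarith
        then show "edge_weight q i b c = 0"
          using \<alpha> by simp
      qed
      then show "p = q" ..
    qed
    moreover have "contextual (circle_sset n) (Delta_sset (Zd d)) p"
      unfolding contextual_def
    proof (intro conjI notI p)
      assume "noncontextual (circle_sset n) (Delta_sset (Zd d)) p"
      then obtain S w where S: "finite S" "S \<subseteq> simplicial_maps (circle_sset n) (Delta_sset (Zd d))"
        and w: "\<forall>\<phi>\<in>S. (0::real) \<le> w \<phi>" "(\<Sum>\<phi>\<in>S. w \<phi>) = 1"
        and mix: "\<forall>m. \<forall>x\<in>simplices (circle_sset n) m. \<forall>y.
          pmf (p m x) y = (\<Sum>\<phi>\<in>S. w \<phi> * pmf (deterministic (circle_sset n) \<phi> m x) y)"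
        unfolding noncontextual_def by blast
      \<comment> \<open>One deterministic component with nonzero weight suffices: its support lies
        in that of \<open>p\<close>, so by \<open>unique\<close> it equals \<open>p\<close>.\<close>
      obtain \<phi> where \<phi>: "\<phi> \<in> S" "w \<phi> \<noteq> 0"
        using w(2) by (metis sum.neutral zero_neq_one)
      let ?q = "deterministic (circle_sset n) \<phi>"
      have "?q = p"
      proof (rule unique)
        show "?q \<in> sDist (circle_sset n) (Delta_sset (Zd d))"
          using S \<phi> by (intro deterministic_in_sDist simplicial_set_circle) auto
        fix i b c assume i: "i \<in> {1..n}" and "edge_weight p i b c = 0"
        then have "(\<Sum>\<phi>\<in>S. w \<phi> * edge_weight (deterministic (circle_sset n) \<phi>) i b c) = 0"
          using mix edge[OF i] by (simp add: edge_weight_def)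
        then have "w \<phi> * edge_weight ?q i b c = 0"
          using S(1) w(1) \<phi>(1) by (subst (asm) sum_nonneg_eq_0_iff) (auto simp: edge_weight_def)
        then show "edge_weight ?q i b c = 0"
          using \<phi>(2) by simp
      qed
      \<comment> \<open>The contradiction: point masses only take the values 0 and 1, whereas
        \<open>p\<close> takes the value \<open>1 / k\<close> with \<open>k\<close> at least
        2.\<close>
      moreover have "edge_weight ?q 1 b c \<in> {0, 1}" for b c
        using edge[of 1] n by (simp add: edge_weight_def deterministic_def indicator_def)
      moreover have "edge_weight p 1 (a 1 1) (cycle_succ n k a 1 1) = 1 / real k"
      proof -
        have "1 \<in> {1..n}" "1 \<in> {1..k}"
          using n k by auto
        moreover from this have "a 1 1 \<in> Zd d"
          by (rule cycle_labels_in[OF a])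
        ultimately show ?thesis
          using cycle_succ_in[OF a, of 1 1] by (subst edge_p) (auto simp: cycle_weight_def)
      qed
      ultimately have "1 / real k \<in> {0, 1}"
        by metis
      with k show False
        by simp
    qed
    ultimately show "contextual (circle_sset n) (Delta_sset (Zd d)) p \<and>
        is_vertex (circle_sset n) (Delta_sset (Zd d)) p"
      by blast
  }
qed

end
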